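(* Let $T_{\alpha,\beta}$ be of type infinity, with associated sequence $(k_i)_{i\ge0}$. Let $L_{n}=\min\{r\ge1: k_{n+r}\ne1\}$. If $$\sum_{i\ge1}\frac{k_{2i}-1}{k_{2i}}\sqrt{\frac1{k_{2i-1}L_{2i}}}=\infty,$$ or $$\prod_{i\ge1}\frac{k_{2i}}{k_{2i-1}+\frac1{L_{2i}}}=0,$$ or if either of these two conditions holds with $2i$ replaced by $2i-1$ (so that $k_{2i},k_{2i-1},L_{2i}$ are replaced by $k_{2i-1},k_{2i-2},L_{2i-1}$ respectively), then $T_{\alpha,\beta}$ is uniquely ergodic.
   Context: Let $U=\{(\alpha,\beta):0\le\beta\le\alpha\le1\}$ with interior $U^\circ$, $L=\{(\alpha,\beta):0\le\alpha\le\beta+1\le1\}$, $R=U\cup L$. For $(\alpha,\beta)\in U^\circ$ define $T_{\alpha,\beta}:[0,1)\to[0,1)$ by $T_{\alpha,\beta}(x)=x+\alpha$ for $x\in[0,1-\alpha)$, $x+\beta$ for $x\in[1-\alpha,1-\beta)$, and $x+\beta-1$ for $x\in[1-\beta,1)$. Put $\Omega_0=[0,1)$, $\Omega_n=T_{\alpha,\beta}(\Omega_{n-1})$, $\Omega=\bigcap_n\Omega_n$; $T_{\alpha,\beta}$ is of type infinity if $\Omega_{n+1}\subsetneq\Omega_n$ for every $n$ (then $\overline\Omega$ is a Cantor set). On $\overline\Omega\setminus\Omega$ the map is (re)defined by continuity from the left. Let $G:U^\circ\to R$, $G(\alpha,\beta)=\big(\frac\beta\alpha,\frac{\beta-1}{\alpha}+\lfloor\frac1\alpha\rfloor\big)$.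 When $T_{\alpha,\beta}$ is of type infinity all iterates $(\alpha_i,\beta_i)=G^i(\alpha,\beta)$, $i\ge0$, are defined and lie in $U^\circ$, and the associated sequence is $k_i=\lfloor 1/\alpha_i\rfloor$; in this sequence $k_{2i}\neq1$ infinitely often and $k_{2i+1}\ne1$ infinitely often, so the $L_n$ are finite. Uniquely ergodic means having exactly one invariant Borel probability measure. An infinite product equals $0$ if its partial products tend to $0$. *)

theory Defs
  imports "HOL-Probability.Probability"
begin

definition paramU :: "(real \<times> real) set" where
  "paramU = {(\<alpha>, \<beta>). 0 \<le> \<beta> \<and> \<beta> \<le> \<alpha> \<and> \<alpha> \<le> 1}"

(* The first and last branches extend beyond [0,1); the values outside [0,1) play no role. *)
definition itm :: "real \<Rightarrow> real \<Rightarrow> real \<Rightarrow> real" where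
  "itm \<alpha> \<beta> x =
     (if x < 1 - \<alpha> then x + \<alpha>
      else if x < 1 - \<beta> then x + \<beta>
      else x + \<beta> - 1)"

primrec itm_image :: "real \<Rightarrow> real \<Rightarrow> nat \<Rightarrow> real set" where
  "itm_image \<alpha> \<beta> 0 = {0..<1}"
| "itm_image \<alpha> \<beta> (Suc n) = itm \<alpha> \<beta> ` itm_image \<alpha> \<beta> n"

definition itm_attractor :: "real \<Rightarrow> real \<Rightarrow> real set" where
  "itm_attractor \<alpha> \<beta> = (\<Inter>n. itm_image \<alpha> \<beta> n)"

definition type_infinity :: "real \<Rightarrow> real \<Rightarrow> bool" where
  "type_infinity \<alpha> \<beta> \<longleftrightarrow> (\<forall>n. itm_image \<alpha> \<beta> (Suc n) \<subset> itm_image \<alpha> \<beta> n)"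

(* The attractor need not be closed: at the points its closure adds (possibly including 1)
   the value is the left-hand limit of the map. *)
definition itm_closure_map :: "real \<Rightarrow> real \<Rightarrow> real \<Rightarrow> real" where
  "itm_closure_map \<alpha> \<beta> x =
     (if x \<in> itm_attractor \<alpha> \<beta> then itm \<alpha> \<beta> x else Lim (at_left x) (itm \<alpha> \<beta>))"

definition invariant_prob :: "real set \<Rightarrow> (real \<Rightarrow> real) \<Rightarrow> real measure \<Rightarrow> bool" where
  "invariant_prob X f M \<longleftrightarrow>
     sets M = sets (restrict_space borel X) \<and> prob_space M \<and>
     f \<in> measurable M M \<and> distr M M f = M"

definition uniquely_ergodic_on :: "real set \<Rightarrow> (real \<Rightarrow> real) \<Rightarrow> bool" where
  "uniquely_ergodic_on X f \<longleftrightarrow> (\<exists>!M. invariant_prob X f M)"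

definition itm_uniquely_ergodic :: "real \<Rightarrow> real \<Rightarrow> bool" where
  "itm_uniquely_ergodic \<alpha> \<beta> \<longleftrightarrow>
     uniquely_ergodic_on (closure (itm_attractor \<alpha> \<beta>)) (itm_closure_map \<alpha> \<beta>)"

(* The renormalization map, meaningful on the interior of paramU; for parameters of type infinity
   all iterates stay there. *)
definition gauss_map :: "real \<times> real \<Rightarrow> real \<times> real" where
  "gauss_map = (\<lambda>(\<alpha>, \<beta>). (\<beta> / \<alpha>, (\<beta> - 1) / \<alpha> + of_int \<lfloor>1 / \<alpha>\<rfloor>))"

definition assoc_seq :: "real \<Rightarrow> real \<Rightarrow> nat \<Rightarrow> nat" where
  "assoc_seq \<alpha> \<beta> i = nat \<lfloor>1 / fst ((gauss_map ^^ i) (\<alpha>, \<beta>))\<rfloor>"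

definition next_non_one :: "(nat \<Rightarrow> nat) \<Rightarrow> nat \<Rightarrow> nat" where
  "next_non_one k n = (LEAST r. 1 \<le> r \<and> k (n + r) \<noteq> 1)"

end

(*
The first return map of T = itm \<alpha> \<beta> to D = [1 - \<alpha>, 1) is an affine copy of the map with
parameters gauss_map (\<alpha>, \<beta>). For an invariant measure, let m n be the mass of the n-th domain
of this nested sequence. Kac's formula gives m n = m (n + 1) + k n * m (n + 2) - m (n + 3),
m tends to 0, and m determines the measure. So the question is whether two positive
solutions m, m' of the recursion are proportional.

Put x n = m n - m (n + 1), z n = m (n + 2), and compare the ratios r n, s n of the two solutions
at x n, z n. Both r n and s n are weighted averages of later ratios, which moves r n and s n
monotonically apart. If s n ever is an upper or lower bound of r n and r (n + 1), then all ratios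
agree. Otherwise s n stays strictly between the limits of r along the even and the odd indices.
This forces k n >= 2 eventually and, for w n = z n / z (n + 1), the convergence of the series of
1 / w n. Since k (n + 2) = w (n + 1) * (w n - 1) + 1 / w (n + 2), the series of 1 / sqrt (k n)
then converges, and the products in the theorem telescope and stay away from 0.

Existence: empirical measures of an orbit have a limit by Helly's theorem. The map has no periodic
points, because the uniform measure on a periodic orbit would have m n bounded below. Therefore the
limit has no atoms and the discontinuities of T do not matter. Likewise an invariant measure on the
closure of the attractor does not charge the countably many points that the closure adds.
*)

theory Submission imports Defs begin

section \<open>Pairs of solutions of the mass recursion\<close>

text \<open>One solution is compared with the sum of both rather than with the other, so that only
  the sum has to be positive and all ratios lie in [0, 1]. The obstacle is that
  \<open>k n = 1\<close> gives \<open>s n\<close> no weight: then \<open>r n = r (n + 2)\<close>,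
  and ones along one parity could stop all movement there. Two facts remove it. First,
  \<open>k n \<ge> 2\<close> recurs in each parity class, since otherwise the lengths of the domains
  would become negative; so a gap that persists on one side cannot be positive. Second, if the
  ratios stay separated, a one right after an index with \<open>k \<ge> 2\<close> forces ones
  backwards along its parity, and therefore ones die out. From then on every \<open>L n\<close> is 1
  and the pattern of ones no longer matters. The main quantitative input is then
  \<open>1 / w n \<le> 4 * (b n - b (n + 2))\<close>: its right side telescopes, and it controls
  both the series and the products, for both parities.\<close>

locale dominated_pair =
  fixes k :: "nat \<Rightarrow> nat" and x z u v :: "nat \<Rightarrow> real"
  assumes k_pos: "1 \<le> k n"
    and k_rec: "\<exists>i. 2 \<le> k (n + 2 * i)"
    and x_pos: "0 < x n" and z_pos: "0 < z n"
    and u_nonneg: "0 \<le> u n" and u_le: "u n \<le> x n"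
    and v_nonneg: "0 \<le> v n" and v_le: "v n \<le> z n"
    and x_step: "x n = x (n + 2) + (real (k n) - 1) * z n"
    and z_step: "z n = z (n + 1) + x (n + 2)"
    and u_step: "u n = u (n + 2) + (real (k n) - 1) * v n"
    and v_step: "v n = v (n + 1) + u (n + 2)"
begin

definition r :: "nat \<Rightarrow> real" where "r n = u n / x n"
definition s :: "nat \<Rightarrow> real" where "s n = v n / z n"

text \<open>Exchanges the roles of the two solutions: the ratios become \<open>1 - r n\<close> and
  \<open>1 - s n\<close>. Every statement about upper bounds thus yields one about lower
  bounds.\<close>

lemma complement: "dominated_pair k x z (\<lambda>n. x n - u n) (\<lambda>n. z n - v n)"
proof
  fix n
  show "x n - u n = x (n + 2) - u (n + 2) + (real (k n) - 1) * (z n - v n)"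
    using x_step[of n] u_step[of n] by (simp add: algebra_simps)
  show "z n - v n = z (n + 1) - v (n + 1) + (x (n + 2) - u (n + 2))"
    using z_step[of n] v_step[of n] by simp
qed (rule k_pos k_rec x_pos z_pos x_step z_step | use u_nonneg u_le v_nonneg v_le in simp)+

lemma r_bounds: "0 \<le> r n" "r n \<le> 1"
  using u_nonneg[of n] u_le[of n] x_pos[of n] by (auto simp: r_def)

lemma u_eq: "u n = r n * x n" using x_pos[of n] by (simp add: r_def)
lemma v_eq: "v n = s n * z n" using z_pos[of n] by (simp add: s_def)

lemma x_le: "x n \<le> real (k n) * z n"
  using x_step[of n] z_step[of n] z_pos[of "n+1"] by (simp add: algebra_simps)

text \<open>The weight of \<open>s n\<close> in the average
  \<open>r n = (1 - \<theta> n) * r (n + 2) + \<theta> n * s n\<close>; it vanishes when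
  \<open>k n = 1\<close>.\<close>

definition \<theta> :: "nat \<Rightarrow> real" where "\<theta> n = (real (k n) - 1) * z n / x n"

lemma theta_ge: "(real (k n) - 1) / real (k n) \<le> \<theta> n"
proof -
  have kz: "0 < real (k n) * z n" "0 \<le> (real (k n) - 1) * z n"
    using k_pos[of n] z_pos[of n] by auto
  have "(real (k n) - 1) / real (k n) = (real (k n) - 1) * z n / (real (k n) * z n)"
    using z_pos[of n] by simp
  also have "\<dots> \<le> \<theta> n" unfolding \<theta>_def
    using kz x_le[of n] x_pos[of n] by (intro divide_left_mono) auto
  finally show ?thesis .
qed

lemma theta_nonneg: "0 \<le> \<theta> n"
  using k_pos[of n] z_pos[of n] x_pos[of n] by (simp add: \<theta>_def)

lemma theta_ge_half: "2 \<le> k n \<Longrightarrow> 1 / 2 \<le> \<theta> n"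
  by (rule order_trans[OF _ theta_ge]) (simp add: field_simps)

lemma theta_less: "\<theta> n < 1"
  using x_step[of n] x_pos[of "n+2"] x_pos[of n] by (simp add: \<theta>_def)

lemma r_step: "r n - r (n + 2) = \<theta> n * (s n - r (n + 2))"
proof -
  have "r n * x n = r (n+2) * x (n+2) + (real (k n) - 1) * (s n * z n)"
    using u_step[of n] unfolding u_eq[of n] u_eq[of "n + 2"] v_eq[of n] .
  moreover have x2: "x (n+2) = x n - (real (k n) - 1) * z n" using x_step[of n] by simp
  ultimately have "(r n - r (n+2)) * x n = (real (k n) - 1) * z n * (s n - r (n+2))"
    unfolding x2 by (simp add: algebra_simps)
  then show ?thesis using x_pos[of n] by (simp add: \<theta>_def field_simps)
qed

lemma r_step': "(1 - \<theta> n) * (s n - r (n + 2)) = s n - r n"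
  using r_step[of n] by (simp add: algebra_simps)

text \<open>\<open>s n\<close> is the average of \<open>s (n + 1)\<close> and
  \<open>r (n + 2)\<close> with weights proportional to \<open>z (n + 1)\<close> and
  \<open>x (n + 2)\<close>; so \<open>s (n + 1)\<close> lies on the side of \<open>s n\<close> away
  from \<open>r (n + 2)\<close>.\<close>

lemma s_step: "s (n + 1) - s n = x (n + 2) / z (n + 1) * (s n - r (n + 2))"
proof -
  have "s n * z n = s (n+1) * z (n+1) + r (n+2) * x (n+2)"
    using v_step[of n] unfolding v_eq[of n] u_eq[of "n + 2"] v_eq[of "n + 1"] .
  then have "(s (n+1) - s n) * z (n+1) = x (n+2) * (s n - r (n+2))"
    unfolding z_step[of n] by (simp add: algebra_simps)
  then show ?thesis using z_pos[of "n+1"] by (simp add: field_simps)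
qed

text \<open>An average lies between its terms, so \<open>r n \<le> s n\<close> leaves only the order
  \<open>r (n + 2) \<le> r n \<le> s n \<le> s (n + 1)\<close>.\<close>

lemma above_step:
  assumes "r n \<le> s n"
  shows "r (n + 2) \<le> r n" "s n \<le> s (n + 1)" "\<theta> n * (s n - r n) \<le> r n - r (n + 2)"
proof -
  have "0 \<le> (1 - \<theta> n) * (s n - r (n + 2))" using assms r_step' by simp
  then have *: "0 \<le> s n - r (n + 2)" using theta_less[of n] by (simp add: zero_le_mult_iff)
  then show "r (n + 2) \<le> r n" using r_step[of n] theta_nonneg[of n]
    by (smt (verit) mult_nonneg_nonneg)
  then show "\<theta> n * (s n - r n) \<le> r n - r (n + 2)"
    using r_step[of n] theta_nonneg[of n] by (simp add: mult_left_mono)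
  have "0 \<le> x (n + 2) / z (n + 1)" using x_pos[of "n+2"] z_pos[of "n+1"] by simp
  then show "s n \<le> s (n + 1)" using s_step[of n] * by (smt (verit) mult_nonneg_nonneg)
qed

text \<open>The hypothesis is inherited by all later indices, so from \<open>N\<close> on
  \<open>r\<close> falls along each parity while \<open>s\<close> grows. A gap \<open>d\<close>
  between them would never close, and each of the infinitely many later indices of that parity with
  \<open>k \<ge> 2\<close> would cost \<open>r\<close> at least \<open>d / 2\<close>, although
  \<open>r\<close> stays in [0, 1].\<close>

lemma above_const:
  assumes "r N \<le> s N" "r (N + 1) \<le> s N"
  shows "r N = s N \<and> r (N + 1) = s N"
proof -
  have inv: "r (N + i) \<le> s (N + i) \<and> r (N + i + 1) \<le> s (N + i)" for i
  proof (induction i)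
    case 0 then show ?case using assms by simp
  next
    case (Suc i)
    then show ?case using above_step[of "N + i"] by simp
  qed
  have r_eq_s: "r n = s n" if n: "N \<le> n" for n
  proof (rule ccontr)
    assume "r n \<noteq> s n"
    obtain i0 where i0: "n = N + i0" using n le_Suc_ex by blast
    define d where "d = s n - r n"
    have "d > 0" using inv[of i0] \<open>r n \<noteq> s n\<close> by (simp add: d_def i0)
    have mono: "r (n + 2 * (i + 1)) \<le> r (n + 2 * i) \<and> s (n + 2 * i) \<le> s (n + 2 * (i + 1))
        \<and> \<theta> (n + 2 * i) * (s (n + 2 * i) - r (n + 2 * i)) \<le> r (n + 2 * i) - r (n + 2 * (i + 1))" for i
    proof -
      have "r (n + 2 * i) \<le> s (n + 2 * i)" "r (n + 2 * i + 1) \<le> s (n + 2 * i + 1)"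
        using inv[of "i0 + 2 * i"] inv[of "i0 + 2 * i + 1"] by (simp_all add: i0 add.assoc)
      from above_step[OF this(1)] above_step(2)[OF this(2)]
      show ?thesis by (simp add: numeral_2_eq_2)
    qed
    have anti: "r (n + 2 * j) \<le> r (n + 2 * i)" if "i \<le> j" for i j
      using that mono by (induction j rule: dec_induct) (auto intro: order_trans)
    have gap: "d \<le> s (n + 2 * i) - r (n + 2 * i)" for i
    proof (induction i)
      case 0 then show ?case by (simp add: d_def)
    next
      case (Suc i) then show ?case using mono[of i] by simp
    qed
    have drop: "\<exists>j. r (n + 2 * j) \<le> r n - real t * (d / 2)" for t
    proof (induction t)
      case 0 show ?case by (intro exI[of _ 0]) simp
    next
      case (Suc t)
      then obtain j where j: "r (n + 2 * j) \<le> r n - real t * (d / 2)" by blast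
      obtain i where i: "2 \<le> k (n + 2 * j + 2 * i)" using k_rec by blast
      define l where "l = j + i"
      have "2 \<le> k (n + 2 * l)" using i by (simp add: l_def algebra_simps)
      then have "d / 2 \<le> \<theta> (n + 2 * l) * (s (n + 2 * l) - r (n + 2 * l))"
        using mult_mono[OF theta_ge_half gap, of "n + 2 * l" l] \<open>d > 0\<close> theta_nonneg by simp
      then have "r (n + 2 * (l + 1)) \<le> r (n + 2 * l) - d / 2" using mono[of l] by linarith
      also have "\<dots> \<le> r (n + 2 * j) - d / 2" using anti[of j l] by (simp add: l_def)
      also have "\<dots> \<le> r n - real (Suc t) * (d / 2)" using j by (simp add: field_simps)
      finally show ?case by blast
    qed
    obtain t :: nat where "2 / d < real t" using reals_Archimedean2 by blast
    then have "1 < real t * (d / 2)" using \<open>d > 0\<close> by (simp add: field_simps)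
    moreover obtain j where "r (n + 2 * j) \<le> r n - real t * (d / 2)" using drop by blast
    ultimately show False using r_bounds(2)[of n] r_bounds(1)[of "n + 2 * j"] by linarith
  qed
  \<comment> \<open>Squeeze: \<open>s (N + 1) = r (N + 1) \<le> s N \<le> s (N + 1)\<close>.\<close>
  have "s (N + 1) = r (N + 1)" using r_eq_s[of "N + 1"] by simp
  then show ?thesis using assms above_step(2)[OF assms(1)] r_eq_s[of N] by auto
qed

text \<open>Forwards the averages cannot leave \<open>c\<close>, because the weight
  \<open>1 - \<theta> n\<close> of \<open>r (n + 2)\<close> is positive. Backwards the recursion
  gives \<open>u n\<close> and \<open>v n\<close> explicitly from later values.\<close>

lemma const_all:
  assumes "r N = c" "r (N + 1) = c" "s N = c"
  shows "u n = c * x n \<and> v n = c * z n"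
proof -
  have up: "r (N + i) = c \<and> r (N + i + 1) = c \<and> s (N + i) = c" for i
  proof (induction i)
    case 0 then show ?case using assms by simp
  next
    case (Suc i)
    then have "s (N + i) - r (N + i + 2) = 0"
      using r_step'[of "N + i"] theta_less[of "N + i"] by auto
    then show ?case using Suc s_step[of "N + i"] by simp
  qed
  have down: "i \<le> N \<Longrightarrow> u (N - i) = c * x (N - i) \<and> u (N - i + 1) = c * x (N - i + 1)
      \<and> v (N - i) = c * z (N - i)" for i
  proof (induction i)
    case 0 then show ?case using assms u_eq[of N] u_eq[of "N+1"] v_eq[of N] by simp
  next
    case (Suc i)
    define n where "n = N - Suc i"
    have "N - i = n + 1" using Suc by (simp add: n_def)
    then have IH: "u (n + 1) = c * x (n + 1)" "u (n + 2) = c * x (n + 2)" "v (n + 1) = c * z (n + 1)"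
      using Suc by auto
    then have "v n = c * z n" using v_step[of n] z_step[of n] by (simp add: algebra_simps)
    moreover have "u n = c * x n"
      unfolding u_step[of n] x_step[of n] using IH \<open>v n = _\<close> by (simp add: algebra_simps)
    ultimately show ?case using IH by (simp add: n_def)
  qed
  show ?thesis
  proof (cases "n \<le> N")
    case True then show ?thesis using down[of "N - n"] by simp
  next
    case False
    then obtain i where "n = N + i" using nat_le_iff_add[of N n] by auto
    then show ?thesis using up[of i] u_eq[of n] v_eq[of n] by simp
  qed
qed

end

text \<open>Here \<open>a n\<close> and \<open>b n\<close> are the distances of \<open>s n\<close> and \<open>r n\<close> to the limit of \<open>r\<close> along the indices
  of the parity of \<open>n\<close>, measured in units of the distance between the two limits.\<close>

locale separated_pair =
  fixes k :: "nat \<Rightarrow> nat" and x z a b :: "nat \<Rightarrow> real"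
  assumes k_pos: "1 \<le> k n"
    and k_rec: "\<exists>i. 2 \<le> k (n + 2 * i)"
    and x_pos: "0 < x n" and z_pos: "0 < z n"
    and x_step: "x n = x (n + 2) + (real (k n) - 1) * z n"
    and z_step: "z n = z (n + 1) + x (n + 2)"
    and b_nonneg: "0 \<le> b n" and b_lim: "b \<longlonglongrightarrow> 0" and b_less: "b (n + 2) < a n"
    and a_step: "z n * a n = z (n + 1) * (1 - a (n + 1)) + x (n + 2) * b (n + 2)"
    and b_step: "(real (k n) - 1) / real (k n) * (a n - b (n + 2)) \<le> b n - b (n + 2)"
begin

lemma b_step_ge2: "2 \<le> k n \<Longrightarrow> a n - b (n + 2) \<le> 2 * (b n - b (n + 2))"
proof -
  assume "2 \<le> k n"
  then have "1 / 2 * (a n - b (n + 2)) \<le> (real (k n) - 1) / real (k n) * (a n - b (n + 2))"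
    using b_less[of n] by (intro mult_right_mono) (auto simp: field_simps)
  from order_trans[OF this b_step] show ?thesis by simp
qed

lemma b_anti: "b (n + 2) \<le> b n"
proof -
  have "0 \<le> (real (k n) - 1) / real (k n) * (a n - b (n + 2))"
    using b_less[of n] k_pos[of n] by simp
  then show ?thesis using b_step[of n] by linarith
qed

lemma a_le_ge2: "2 \<le> k n \<Longrightarrow> a n \<le> 3 * b n"
  using b_step_ge2[of n] b_nonneg[of "n+2"] b_anti[of n] by fastforce

text \<open>Two applications of \<open>a_step\<close> write \<open>z m * a m\<close> as a sum that
  contains \<open>z (m + 2) * a (m + 2)\<close> and \<open>x (m + 3) * (1 - b (m + 3))\<close>. As
  \<open>x (m + 2) = x (m + 4) \<le> x (m + 3)\<close>, half of \<open>x (m + 3)\<close> pays for a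
  quarter of both \<open>x\<close> terms in
  \<open>z m = z (m + 2) + x (m + 3) + x (m + 2)\<close>.\<close>

lemma large_step:
  assumes "1 / 4 \<le> a (m + 2)" "x (m + 4) \<le> x (m + 3)" "k (m + 2) = 1" "b (m + 3) \<le> 1 / 2"
  shows "1 / 4 \<le> a m" "x (m + 2) \<le> x (m + 1)"
proof -
  have x2: "x (m + 2) = x (m + 4)" using x_step[of "m + 2"] assms(3) by (simp add: numeral_eq_Suc)
  have z2: "z m = z (m + 2) + x (m + 3) + x (m + 2)" "z (m + 1) = z (m + 2) + x (m + 3)"
    using z_step[of m] z_step[of "m + 1"] by (simp_all add: numeral_eq_Suc)
  have zp: "0 < z m" "0 < z (m + 2)" "0 < x (m + 3)" "0 < x (m + 2)" using z_pos x_pos by auto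
  have a1: "z (m + 1) * a (m + 1) = z (m + 2) * (1 - a (m + 2)) + x (m + 3) * b (m + 3)"
    using a_step[of "m + 1"] by (simp add: numeral_eq_Suc)
  have "z m * a m = z (m + 1) - z (m + 1) * a (m + 1) + x (m + 2) * b (m + 2)"
    using a_step[of m] by (simp add: algebra_simps)
  also have "\<dots> = x (m + 3) * (1 - b (m + 3)) + z (m + 2) * a (m + 2) + x (m + 2) * b (m + 2)"
    using a1 unfolding z2 by (simp add: algebra_simps)
  also have "\<dots> \<ge> x (m + 3) * (1 / 2) + z (m + 2) * (1 / 4) + 0"
    using assms(1,4) zp b_nonneg[of "m+2"]
    by (intro add_mono mult_left_mono mult_nonneg_nonneg) auto
  finally have "z m * (1 / 4) \<le> z m * a m" using z2 x2 assms(2) by linarith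
  then show "1 / 4 \<le> a m" using zp by simp
  have "x (m + 3) \<le> x (m + 1)"
    using x_step[of "m + 1"] k_pos[of "m + 1"] z_pos[of "m + 1"] by (simp add: numeral_eq_Suc)
  then show "x (m + 2) \<le> x (m + 1)" using x2 assms(2) by linarith
qed

lemma eventually_ge2: "\<exists>N. \<forall>n\<ge>N. 2 \<le> k n"
proof -
  \<comment> \<open>Wherever \<open>k n \<ge> 2\<close> this makes
    \<open>a n \<le> 3 * b n < 1 / 8\<close>, which is incompatible with the bound 1/4 of
    \<open>large_step\<close> and small enough to start the backward chain.\<close>
  have "eventually (\<lambda>n. b n < 1 / 24) sequentially"
    using b_lim by (rule order_tendstoD) simp
  then obtain n0 where n0: "\<And>n. n0 \<le> n \<Longrightarrow> b n < 1 / 24"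
    by (auto simp: eventually_sequentially)
  \<comment> \<open>If \<open>k p \<ge> 2\<close> but \<open>k (p + 1) = 1\<close>, the bound \<open>a m \<ge> 1 / 4\<close> propagates backwards through the indices \<open>m\<close> of the
    parity of \<open>p + 1\<close>; it excludes \<open>k m \<ge> 2\<close>, since then \<open>a m \<le> 3 * b m\<close> is small.\<close>
  have gap: "k (p + 1 - 2 * i) = 1"
    if p: "2 \<le> k p" "k (p + 1) = 1" "n0 + 1 \<le> p" and i: "1 \<le> i" "n0 + 2 * i \<le> p + 1" for p i
  proof -
    have "1 / 4 \<le> a (p + 1 - 2 * i) \<and> x (p + 3 - 2 * i) \<le> x (p + 2 - 2 * i) \<and> k (p + 1 - 2 * i) = 1"
      using i
    proof (induction i rule: dec_induct)
      case base
      define m where "m = p - 1"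
      have pm: "p = m + 1" using p by (simp add: m_def)
      have ap: "a p \<le> 1 / 8" using a_le_ge2[OF p(1)] n0[of p] p(3) by simp
      have "x (p + 1) = x (p + 3)" using x_step[of "p + 1"] p(2) by (simp add: numeral_eq_Suc)
      also have "\<dots> \<le> z (p + 1)" using z_step[of "p + 1"] z_pos[of "p + 2"] by (simp add: numeral_eq_Suc)
      also have "\<dots> \<le> z p" using z_step[of p] x_pos[of "p + 2"] by simp
      finally have xz: "x (p + 1) \<le> z p" .
      have "1 * z p \<le> (real (k p) - 1) * z p"
        using p(1) z_pos[of p] by (intro mult_right_mono) auto
      then have "z p \<le> x p" using x_step[of p] x_pos[of "p + 2"] by simp
      with xz have xx: "x (p + 1) \<le> x p" by simp
      have zm: "z m = z p + x (p + 1)" using z_step[of m] pm by simp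
      \<comment> \<open>Here \<open>z m \<le> 2 * z p\<close>, and the term
        \<open>z p * (1 - a p)\<close> alone gives \<open>a m \<ge> 7 / 16\<close>.\<close>
      have "z m * a m = z p * (1 - a p) + x (p + 1) * b (p + 1)"
        using a_step[of m] pm by simp
      also have "\<dots> \<ge> z p * (7 / 8) + 0"
        using ap z_pos[of p] x_pos[of "p+1"] b_nonneg[of "p+1"]
        by (intro add_mono mult_left_mono mult_nonneg_nonneg) auto
      finally have "z m * (1 / 4) \<le> z m * a m" using zm xz z_pos[of p] by linarith
      then have am: "1 / 4 \<le> a m" using z_pos[of m] by simp
      have "\<not> 2 \<le> k m"
        using a_le_ge2[of m] am n0[of m] p(3) pm by fastforce
      then have "k m = 1" using k_pos[of m] by simp
      then show ?case using am xx pm by (simp add: numeral_eq_Suc)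
    next
      case (step i)
      define m where "m = p + 1 - 2 * Suc i"
      have m: "p + 1 - 2 * i = m + 2" "p + 3 - 2 * i = m + 4" "p + 2 - 2 * i = m + 3"
        "p + 3 - 2 * Suc i = m + 2" "p + 2 - 2 * Suc i = m + 1" "n0 \<le> m"
        using step.prems by (auto simp: m_def)
      have IH: "1 / 4 \<le> a (m + 2)" "x (m + 4) \<le> x (m + 3)" "k (m + 2) = 1"
        using step.IH step.prems unfolding m by auto
      note Q = large_step[OF IH] n0[of "m + 3"] m(6)
      have am: "1 / 4 \<le> a m" "x (m + 2) \<le> x (m + 1)" using Q by auto
      have "\<not> 2 \<le> k m" using a_le_ge2[of m] am n0[of m] m(6) by fastforce
      then have "k m = 1" using k_pos[of m] by simp
      then show ?case unfolding m(4,5) m_def[symmetric] using am by simp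
    qed
    then show ?thesis by simp
  qed
  \<comment> \<open>An earlier \<open>c\<close> at odd distance from \<open>p\<close> has the parity
    of \<open>p + 1\<close>, so the backward chain of ones from \<open>p + 1\<close> would run into
    it.\<close>
  have succ: "2 \<le> k (p + 1)" if p: "2 \<le> k p" "n0 + 1 \<le> p" and c: "n0 \<le> c" "2 \<le> k c" "c < p" "odd (p - c)" for p c
  proof (rule ccontr)
    assume "\<not> 2 \<le> k (p + 1)"
    then have 1: "k (p + 1) = 1" using k_pos[of "p+1"] by simp
    obtain j where j: "p - c = 2 * j + 1" using c(4) by (rule oddE)
    have "k (p + 1 - 2 * (j + 1)) = 1" using j c by (intro gap[OF p(1) 1 p(2)]) auto
    moreover have "p + 1 - 2 * (j + 1) = c" using j c by simp
    ultimately show False using c by simp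
  qed
  \<comment> \<open>One index with \<open>k \<ge> 2\<close> in each parity class serves every later
    \<open>p\<close>.\<close>
  obtain i where i: "2 \<le> k (n0 + 2 * i)" using k_rec by blast
  obtain j where j: "2 \<le> k (n0 + 1 + 2 * j)" using k_rec by blast
  define c d where "c = n0 + 2 * i" and "d = n0 + 1 + 2 * j"
  define N where "N = max c d + 1"
  have N: "c < N" "d < N" by (auto simp: N_def)
  have step: "2 \<le> k (p + 1)" if "2 \<le> k p" "N \<le> p" for p
  proof (cases "odd (p - c)")
    case True then show ?thesis using succ[OF that(1), of c] that N i by (auto simp: c_def)
  next
    case False
    then have "odd (p - d)" using that N by (auto simp: c_def d_def)
    then show ?thesis using succ[OF that(1), of d] that N j by (auto simp: d_def)
  qed
  obtain l where l: "2 \<le> k (N + 2 * l)" using k_rec by blast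
  have "2 \<le> k n" if "N + 2 * l \<le> n" for n
    using that
  proof (induction n rule: dec_induct)
    case base then show ?case using l by simp
  next
    case (step n) then show ?case using \<open>\<And>p. 2 \<le> k p \<Longrightarrow> N \<le> p \<Longrightarrow> 2 \<le> k (p + 1)\<close>[of n] by simp
  qed
  then show ?thesis by blast
qed


section \<open>Quotients of consecutive masses and the two conditions\<close>

definition w :: "nat \<Rightarrow> real" where "w n = z n / z (n + 1)"

lemma w_gt_1: "1 < w n"
  using z_step[of n] x_pos[of "n + 2"] z_pos[of "n + 1"] by (simp add: w_def)

text \<open>Eliminating \<open>x\<close> gives
  \<open>z n - z (n + 1) = k (n + 2) * z (n + 2) - z (n + 3)\<close>; this is the quotient by
  \<open>z (n + 2)\<close>.\<close>

lemma k_eq: "real (k (n + 2)) = w (n + 1) * (w n - 1) + 1 / w (n + 2)"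
proof -
  have zp: "0 < z n" "0 < z (n + 1)" "0 < z (n + 2)" "0 < z (n + 3)" using z_pos by auto
  have "z n - z (n + 1) = real (k (n + 2)) * z (n + 2) - z (n + 3)"
    using z_step[of n] x_step[of "n + 2"] z_step[of "n + 2"]
    by (simp add: algebra_simps numeral_eq_Suc)
  then have "real (k (n + 2)) = (z n - z (n + 1) + z (n + 3)) / z (n + 2)"
    using zp by (subst eq_divide_eq) auto
  then have "real (k (n + 2)) = (z n - z (n + 1)) / z (n + 2) + z (n + 3) / z (n + 2)"
    by (simp add: add_divide_distrib)
  moreover have "w (n + 1) * (w n - 1) = (z n - z (n + 1)) / z (n + 2)"
    using zp by (simp add: w_def field_simps)
  moreover have "1 / w (n + 2) = z (n + 3) / z (n + 2)"
    by (simp add: w_def numeral_eq_Suc)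
  ultimately show ?thesis by simp
qed

text \<open>Subtracting \<open>z n * b (n + 2)\<close> from \<open>a_step\<close> gives
  \<open>w n * (a n - b (n + 2)) = 1 - a (n + 1) - b (n + 2)\<close>. With \<open>b < 1 / 8\<close>
  and \<open>a \<le> 3 * b\<close> the right side is at least 1/2, and
  \<open>a n - b (n + 2)\<close> is at most twice the decrement of \<open>b\<close>.\<close>

lemma eventually_w:
  "\<exists>N. \<forall>n\<ge>N. 2 \<le> k n \<and> 2 \<le> w n \<and> 1 / w n \<le> 4 * (b n - b (n + 2)) \<and> b n \<le> 1 / 8"
proof -
  obtain N0 where N0: "\<And>n. N0 \<le> n \<Longrightarrow> 2 \<le> k n" using eventually_ge2 by blast
  have "eventually (\<lambda>n. b n < 1 / 8) sequentially"
    using b_lim by (rule order_tendstoD) simp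
  then obtain N1 where N1: "\<And>n. N1 \<le> n \<Longrightarrow> b n < 1 / 8"
    by (auto simp: eventually_sequentially)
  have "2 \<le> k n \<and> 2 \<le> w n \<and> 1 / w n \<le> 4 * (b n - b (n + 2)) \<and> b n \<le> 1 / 8"
    if n: "max N0 N1 \<le> n" for n
  proof -
    have k: "2 \<le> k n" "2 \<le> k (n + 1)" using n by (auto intro: N0)
    have b: "b n < 1 / 8" "b (n + 1) < 1 / 8" "b (n + 2) < 1 / 8" using N1[of n] N1[of "n + 1"] N1[of "n + 2"] n by auto
    have "z n * (a n - b (n + 2)) = z (n + 1) * (1 - a (n + 1) - b (n + 2))"
      using a_step[of n] z_step[of n] by (simp add: algebra_simps)
    then have "w n * (a n - b (n + 2)) = 1 - a (n + 1) - b (n + 2)"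
      using z_pos[of "n + 1"] by (simp add: w_def field_simps)
    also have "\<dots> \<ge> 1 / 2" using a_le_ge2[OF k(2)] b by simp
    finally have "1 / w n \<le> 2 * (a n - b (n + 2))"
      using w_gt_1[of n] by (simp add: field_simps)
    also have "\<dots> \<le> 4 * (b n - b (n + 2))" using b_step_ge2[OF k(1)] by simp
    finally have *: "1 / w n \<le> 4 * (b n - b (n + 2))" .
    then have "1 / w n \<le> 1 / 2" using b(1) b_nonneg[of "n + 2"] by simp
    then have "2 \<le> w n" using w_gt_1[of n] by (simp add: field_simps)
    with k * b show ?thesis by simp
  qed
  then show ?thesis by blast
qed

lemma summable_inverse_w: "summable (\<lambda>n. 1 / w n)"
proof -
  obtain N where N: "\<And>n. N \<le> n \<Longrightarrow> 1 / w n \<le> 4 * (b n - b (n + 2))"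
    using eventually_w by blast
  have "summable (\<lambda>n. b n - b (Suc n))" by (rule telescope_summable'[OF b_lim])
  then have "summable (\<lambda>n. (b n - b (Suc n)) + (b (Suc n) - b (Suc (Suc n))))"
    by (intro summable_add) (auto simp: summable_Suc_iff[where f = "\<lambda>n. b n - b (Suc n)"])
  then have sum: "summable (\<lambda>n. 4 * (b n - b (n + 2)))"
    by (intro summable_mult) simp
  have "norm (1 / w n) \<le> 4 * (b n - b (n + 2))" if "N \<le> n" for n
    using N[OF that] w_gt_1[of n] by simp
  then have "eventually (\<lambda>n. norm (1 / w n) \<le> 4 * (b n - b (n + 2))) sequentially"
    by (rule eventually_sequentiallyI)
  then show ?thesis using sum by (rule summable_comparison_test_ev)
qed

text \<open>By \<open>k_eq\<close> and \<open>w n \<ge> 2\<close>, \<open>1 / k (n + 2)\<close> is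
  at most twice the product of \<open>1 / w n\<close> and \<open>1 / w (n + 1)\<close>, hence at
  most the square of their sum.\<close>

lemma summable_sqrt_k: "summable (\<lambda>n. sqrt (1 / real (k n)))"
proof -
  obtain N where N: "\<And>n. N \<le> n \<Longrightarrow> 2 \<le> w n"
    using eventually_w by blast
  have le: "sqrt (1 / real (k (n + 2))) \<le> 1 / w n + 1 / w (n + 1)" if "N \<le> n" for n
  proof (rule real_le_lsqrt)
    have w: "2 \<le> w n" "1 < w (n + 1)" "1 < w (n + 2)" using N[OF that] w_gt_1 by auto
    have "w (n + 1) * (w n / 2) \<le> w (n + 1) * (w n - 1)"
      using w by (intro mult_left_mono) auto
    also have "\<dots> \<le> real (k (n + 2))" using k_eq[of n] w by simp
    finally have "1 / real (k (n + 2)) \<le> 1 / (w (n + 1) * (w n / 2))"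
      using w by (intro divide_left_mono) (auto intro!: mult_pos_pos simp: k_pos Suc_le_lessD k_pos[unfolded One_nat_def])
    also have "\<dots> = 2 * (1 / w n) * (1 / w (n + 1))" by simp
    also have "\<dots> \<le> (1 / w n + 1 / w (n + 1))\<^sup>2"
      unfolding power2_sum by simp
    finally show "1 / real (k (n + 2)) \<le> (1 / w n + 1 / w (n + 1))\<^sup>2" .
    show "0 \<le> 1 / w n + 1 / w (n + 1)" using w by simp
  qed
  have "summable (\<lambda>n. 1 / w n + 1 / w (n + 1))"
    using summable_inverse_w by (intro summable_add) (auto simp: summable_Suc_iff[where f = "\<lambda>n. 1 / w n"])
  then have "summable (\<lambda>n. sqrt (1 / real (k (n + 2))))"
    by (rule summable_comparison_test_ev[rotated])
      (use le in \<open>auto simp: eventually_sequentially intro!: exI[of _ N]\<close>)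
  then show ?thesis by (subst (asm) summable_iff_shift)
qed

text \<open>\<open>c = 0\<close> and \<open>c = 1\<close> are the two parities of the theorem. Only
  the factor with \<open>k (2 * i - 1 - c)\<close> is used: the others are at most 1, and the
  indices are distinct.\<close>

lemma series_bounded:
  fixes L :: "nat \<Rightarrow> nat"
  assumes "c \<le> 1"
  shows "\<not> filterlim (\<lambda>M. \<Sum>i=1..M. (real (k (2 * i - c)) - 1) / real (k (2 * i - c))
            * sqrt (1 / (real (k (2 * i - 1 - c)) * real (L (2 * i - c))))) at_top sequentially"
    (is "\<not> filterlim (\<lambda>M. \<Sum>i=1..M. ?f i) _ _")
proof
  assume *: "filterlim (\<lambda>M. \<Sum>i=1..M. ?f i) at_top sequentially"
  define S where "S = (\<Sum>n. sqrt (1 / real (k n)))"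
  have term_le: "?f i \<le> sqrt (1 / real (k (2 * i - 1 - c)))" for i
  proof -
    define l where "l = L (2 * i - c)"
    \<comment> \<open>\<open>l = 0\<close> is possible for an arbitrary \<open>L\<close>; the
      quotient is then 0 by convention.\<close>
    have "1 / (real (k (2 * i - 1 - c)) * real l) \<le> 1 / real (k (2 * i - 1 - c))"
      using k_pos[of "2 * i - 1 - c"] by (cases "l = 0") (auto simp: field_simps)
    then have "?f i \<le> 1 * sqrt (1 / real (k (2 * i - 1 - c)))"
      using k_pos[of "2 * i - c"] unfolding l_def by (intro mult_mono) auto
    then show ?thesis by simp
  qed
  have "(\<Sum>i=1..M. ?f i) \<le> S" for M
  proof -
    have inj: "inj_on (\<lambda>i. 2 * i - 1 - c) {1..M}" using assms by (auto simp: inj_on_def)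
    have "(\<Sum>i=1..M. ?f i) \<le> (\<Sum>i=1..M. sqrt (1 / real (k (2 * i - 1 - c))))"
      by (intro sum_mono term_le)
    also have "\<dots> = (\<Sum>n\<in>(\<lambda>i. 2 * i - 1 - c) ` {1..M}. sqrt (1 / real (k n)))"
      by (subst sum.reindex[OF inj]) (simp add: o_def)
    also have "\<dots> \<le> S" unfolding S_def
      by (intro sum_le_suminf summable_sqrt_k) auto
    finally show ?thesis .
  qed
  moreover obtain M where "S + 1 \<le> (\<Sum>i=1..M. ?f i)"
    using * unfolding filterlim_at_top eventually_sequentially by blast
  ultimately show False by (smt (verit))
qed

text \<open>Late factors are at least \<open>w (n + 1) / w (n - 1) * (1 - 1 / w n)\<close>. The
  quotients telescope along the parity, where \<open>w > 1\<close> keeps them from 0, and the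
  remaining product is positive because \<open>1 / w n\<close> is summable.\<close>

lemma product_bounded_below:
  fixes L :: "nat \<Rightarrow> nat"
  assumes "c \<le> 1" and L: "\<And>n. 2 \<le> k (n + 1) \<Longrightarrow> L n = 1"
  shows "\<not> (\<lambda>M. \<Prod>i=1..M. real (k (2 * i - c))
            / (real (k (2 * i - 1 - c)) + 1 / real (L (2 * i - c)))) \<longlonglongrightarrow> 0"
    (is "\<not> (\<lambda>M. \<Prod>i=1..M. ?f i) \<longlonglongrightarrow> 0")
proof
  assume lim: "(\<lambda>M. \<Prod>i=1..M. ?f i) \<longlonglongrightarrow> 0"
  obtain N where N: "\<And>n. N \<le> n \<Longrightarrow> 2 \<le> k n \<and> 2 \<le> w n \<and> 1 / w n \<le> 4 * (b n - b (n + 2)) \<and> b n \<le> 1 / 8"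
    using eventually_w by blast
  have f_pos: "0 < ?f i" for i
    using k_pos[of "2 * i - c"] k_pos[of "2 * i - 1 - c"]
    by (intro divide_pos_pos add_pos_nonneg) auto
  have factor: "w (n + 1) / w (n - 1) * (1 - 1 / w n) \<le> real (k (n + 2)) / (real (k (n + 1)) + 1 / real (L (n + 2)))"
    if n: "N + 1 \<le> n" for n
  proof -
    have w: "1 < w (n - 1)" "2 \<le> w n" "1 < w (n + 1)" "1 < w (n + 2)"
      using w_gt_1 N[of n] n by auto
    have "L (n + 2) = 1" using L[of "n + 2"] N[of "n + 3"] n by (simp add: numeral_eq_Suc)
    \<comment> \<open>By \<open>k_eq\<close> the left side is
      \<open>w (n - 1) * w n - w n + 1 + 1 / w (n + 1)\<close>, and \<open>w n \<ge> 2\<close>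
      outweighs the last two terms.\<close>
    have kn: "real (k (n + 1)) + 1 \<le> w (n - 1) * w n"
      using k_eq[of "n - 1"] w n by (simp add: algebra_simps) (smt (verit) divide_le_eq_1)
    have "w (n + 1) / w (n - 1) * (1 - 1 / w n) = w (n + 1) * (w n - 1) / (w (n - 1) * w n)"
      using w by (simp add: field_simps)
    also have "\<dots> \<le> real (k (n + 2)) / (w (n - 1) * w n)"
      using w k_eq[of n] by (intro divide_right_mono) auto
    also have "\<dots> \<le> real (k (n + 2)) / (real (k (n + 1)) + 1)"
      using kn w by (intro divide_left_mono mult_pos_pos) auto
    finally show ?thesis using \<open>L (n + 2) = 1\<close> by simp
  qed
  \<comment> \<open>The losses \<open>1 - 1 / w n\<close> are absorbed by the decreasing weight \<open>1 / 2 + 4 * b n\<close>.\<close>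
  define I where "I = N + 2"
  define C where "C = (\<Prod>i=1..I. ?f i) / (w (2 * I - c - 1) * (1 / 2 + 4 * b (2 * I - c)))"
  have pos: "0 < w n * (1 / 2 + 4 * b m)" for n m
    using w_gt_1[of n] b_nonneg[of m] by (intro mult_pos_pos) auto
  have "0 < C" unfolding C_def by (intro divide_pos_pos prod_pos pos f_pos)
  have bound: "C * (w (2 * M - c - 1) * (1 / 2 + 4 * b (2 * M - c))) \<le> (\<Prod>i=1..M. ?f i)" if "I \<le> M" for M
    using that
  proof (induction M rule: dec_induct)
    case base
    have "p / q * q \<le> p" if "0 < q" for p q :: real using that by simp
    then show ?case unfolding C_def using pos by blast
  next
    case (step M)
    define n where "n = 2 * M - c"
    have n: "2 * Suc M - c = n + 2" "2 * Suc M - 1 - c = n + 1" "2 * M - c - 1 = n - 1"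
      "2 * Suc M - c - 1 = n + 1" "N + 1 \<le> n"
      using step.hyps assms(1) by (auto simp: n_def I_def)
    define \<Delta> where "\<Delta> = b n - b (n + 2)"
    have Nn: "2 \<le> w n" "1 / w n \<le> 4 * \<Delta>" "b n \<le> 1 / 8" "0 \<le> b n" using N[of n] n(5) b_nonneg[of n]
      by (auto simp: \<Delta>_def)
    have "0 \<le> \<Delta>" using b_anti[of n] by (simp add: \<Delta>_def)
    \<comment> \<open>The weight is at most 1 because \<open>b n \<le> 1 / 8\<close>, so subtracting
      \<open>4 * \<Delta>\<close> lowers it at least as much as multiplying by
      \<open>1 - 4 * \<Delta>\<close>.\<close>
    have "\<Delta> * (16 * b n) \<le> \<Delta> * 2" using Nn \<open>0 \<le> \<Delta>\<close> by (intro mult_left_mono) auto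
    then have "1 / 2 + 4 * b (n + 2) \<le> (1 / 2 + 4 * b n) * (1 - 4 * \<Delta>)"
      by (simp add: \<Delta>_def algebra_simps)
    also have "\<dots> \<le> (1 / 2 + 4 * b n) * (1 - 1 / w n)"
      using Nn by (intro mult_left_mono) auto
    finally have key: "1 / 2 + 4 * b (n + 2) \<le> (1 / 2 + 4 * b n) * (1 - 1 / w n)" .
    have "C * (w (n + 1) * (1 / 2 + 4 * b (n + 2))) \<le> C * (w (n + 1) * ((1 / 2 + 4 * b n) * (1 - 1 / w n)))"
      using key \<open>0 < C\<close> w_gt_1[of "n+1"] by (intro mult_left_mono) auto
    also have "\<dots> = C * (w (n - 1) * (1 / 2 + 4 * b n)) * (w (n + 1) / w (n - 1) * (1 - 1 / w n))"
      using w_gt_1[of "n - 1"] by simp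
    also have "\<dots> \<le> (\<Prod>i=1..M. ?f i) * ?f (Suc M)"
    proof (intro mult_mono)
      show "C * (w (n - 1) * (1 / 2 + 4 * b n)) \<le> (\<Prod>i=1..M. ?f i)"
        using step.IH n(3) unfolding n_def by simp
      show "w (n + 1) / w (n - 1) * (1 - 1 / w n) \<le> ?f (Suc M)"
        using factor[OF n(5)] unfolding n(1,2) .
      show "0 \<le> (\<Prod>i=1..M. ?f i)" using f_pos by (intro prod_nonneg) (auto intro: less_imp_le)
      show "0 \<le> w (n + 1) / w (n - 1) * (1 - 1 / w n)"
        using w_gt_1[of "n + 1"] w_gt_1[of "n - 1"] Nn by simp
    qed
    also have "\<dots> = (\<Prod>i=1..Suc M. ?f i)" by simp
    finally show ?case unfolding n(4) unfolding n(1) .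
  qed
  have "C / 2 \<le> (\<Prod>i=1..M. ?f i)" if "I \<le> M" for M
  proof -
    have "1 * (1 / 2) \<le> w (2 * M - c - 1) * (1 / 2 + 4 * b (2 * M - c))"
      using w_gt_1[of "2 * M - c - 1"] b_nonneg[of "2 * M - c"] by (intro mult_mono) auto
    then have "C * (1 / 2) \<le> C * (w (2 * M - c - 1) * (1 / 2 + 4 * b (2 * M - c)))"
      using \<open>0 < C\<close> by (intro mult_left_mono) auto
    then show ?thesis using bound[OF that] by simp
  qed
  then have "C / 2 \<le> 0" by (intro LIMSEQ_le_const[OF lim]) blast
  then show False using \<open>0 < C\<close> by simp
qed

end

section \<open>The three cases for the ratios\<close>

context dominated_pair
begin

lemma below_step:
  assumes "s n \<le> r n"
  shows "r n \<le> r (n + 2)" "s (n + 1) \<le> s n"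
proof -
  interpret c: dominated_pair k x z "\<lambda>n. x n - u n" "\<lambda>n. z n - v n" by (rule complement)
  have *: "c.r m = 1 - r m" "c.s m = 1 - s m" for m
    using x_pos[of m] z_pos[of m] unfolding c.r_def c.s_def r_def s_def
    by (simp_all add: diff_divide_distrib)
  show "r n \<le> r (n + 2)" "s (n + 1) \<le> s n"
    using c.above_step[of n] assms unfolding * by simp_all
qed

text \<open>Each \<open>s n\<close> separates \<open>r n\<close> from \<open>r (n + 1)\<close>, and
  the steps preserve the orientation, so the even ratios decrease to \<open>e\<close> and the odd
  ones increase to \<open>l\<close>. The chain \<open>e \<le> r 0 < s 0 < r 1 \<le> l\<close> makes
  the unit of length \<open>D\<close> positive.\<close>

lemma separated:
  assumes not_above: "\<And>n. \<not> (r n \<le> s n \<and> r (n + 1) \<le> s n)"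
    and not_below: "\<And>n. \<not> (s n \<le> r n \<and> s n \<le> r (n + 1))"
    and init: "r 0 < s 0"
  shows "\<exists>a b. separated_pair k x z a b"
proof -
  have order: "if even n then r n < s n \<and> s n < r (n + 1) else r (n + 1) < s n \<and> s n < r n" for n
  proof (induction n)
    case 0 then show ?case using init not_above[of 0] by auto
  next
    case (Suc n)
    show ?case
    proof (cases "even n")
      case True
      then have "r n < s n" using Suc by simp
      then have "r (n + 2) < s (n + 1)" using above_step[of n] by simp
      then show ?thesis using True not_above[of "n + 1"] by (simp add: not_le)
    next
      case False
      then have "s n < r n" using Suc by simp
      then have "s (n + 1) < r (n + 2)" using below_step[of n] by simp
      then show ?thesis using False not_below[of "n + 1"] by (simp add: not_le)
    qed
  qed
  have even_step: "r (n + 2) \<le> r n" if "even n" for n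
    using order[of n] that by (intro above_step) simp
  have odd_step: "r n \<le> r (n + 2)" if "odd n" for n
    using order[of n] that by (intro below_step) simp
  have dec: "decseq (\<lambda>i. r (2 * i))"
    by (intro decseq_SucI) (use even_step[of "2 * i" for i] in simp)
  have inc: "incseq (\<lambda>i. r (2 * i + 1))"
    by (intro incseq_SucI) (use odd_step[of "2 * i + 1" for i] in simp)
  obtain e where e: "(\<lambda>i. r (2 * i)) \<longlonglongrightarrow> e" "\<And>i. e \<le> r (2 * i)"
    using decseq_convergent[OF dec, of 0] r_bounds by blast
  obtain l where l: "(\<lambda>i. r (2 * i + 1)) \<longlonglongrightarrow> l" "\<And>i. r (2 * i + 1) \<le> l"
    using incseq_convergent[OF inc, of 1] r_bounds by blast
  have "e < l" using e(2)[of 0] l(2)[of 0] order[of 0] by simp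
  define D where "D = l - e"
  have D: "0 < D" using \<open>e < l\<close> by (simp add: D_def)
  define a where "a n = (if even n then s n - e else l - s n) / D" for n
  define b where "b n = (if even n then r n - e else l - r n) / D" for n
  have ab: "b (n + 2) < a n" for n
  proof -
    have "r (n + 2) < s n" if "even n" using order[of n] even_step[of n] that by simp
    moreover have "s n < r (n + 2)" if "odd n" using order[of n] odd_step[of n] that by simp
    ultimately show ?thesis using D by (simp add: a_def b_def divide_strict_right_mono)
  qed
  have "separated_pair k x z a b"
  proof
    fix n
    show "0 \<le> b n"
    proof (cases "even n")
      case True
      then obtain i where "n = 2 * i" by (rule evenE)
      then show ?thesis using e(2)[of i] D by (simp add: b_def)
    next
      case False
      then obtain i where "n = 2 * i + 1" by (rule oddE)
      then show ?thesis using l(2)[of i] D by (simp add: b_def)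
    qed
    show "b (n + 2) < a n" by (rule ab)
    show "z n * a n = z (n + 1) * (1 - a (n + 1)) + x (n + 2) * b (n + 2)"
    proof -
      have v: "z n * s n = z (n + 1) * s (n + 1) + x (n + 2) * r (n + 2)"
        using v_step[of n] unfolding v_eq[of n] u_eq[of "n + 2"] v_eq[of "n + 1"] by (simp add: mult.commute)
      have "1 - a (n + 1) = (if even n then s (n + 1) - e else l - s (n + 1)) / D"
        using \<open>e < l\<close> by (simp add: a_def D_def field_simps)
      then have "z (n + 1) * (1 - a (n + 1)) + x (n + 2) * b (n + 2) =
        (if even n then z (n + 1) * (s (n + 1) - e) + x (n + 2) * (r (n + 2) - e)
         else z (n + 1) * (l - s (n + 1)) + x (n + 2) * (l - r (n + 2))) / D"
        by (simp add: b_def add_divide_distrib)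
      also have "\<dots> = (if even n then z n * (s n - e) else z n * (l - s n)) / D"
        using v z_step[of n] by (simp add: algebra_simps)
      finally show ?thesis by (simp add: a_def)
    qed
    show "(real (k n) - 1) / real (k n) * (a n - b (n + 2)) \<le> b n - b (n + 2)"
    proof -
      have "b n - b (n + 2) = \<theta> n * (a n - b (n + 2))"
        using r_step[of n] D unfolding a_def b_def
        by (auto simp: diff_divide_distrib[symmetric] algebra_simps)
      moreover have "(real (k n) - 1) / real (k n) * (a n - b (n + 2)) \<le> \<theta> n * (a n - b (n + 2))"
        using theta_ge[of n] ab[of n] by (intro mult_right_mono) auto
      ultimately show ?thesis by simp
    qed
    show "b \<longlonglongrightarrow> 0"
    proof -
      have "(\<lambda>i. (r (2 * i) - e) / D) \<longlonglongrightarrow> (e - e) / D"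
        using D by (intro tendsto_intros e) auto
      then have ev: "(\<lambda>i. b (2 * i)) \<longlonglongrightarrow> 0" by (simp add: b_def)
      have "(\<lambda>i. (l - r (2 * i + 1)) / D) \<longlonglongrightarrow> (l - l) / D"
        using D by (intro tendsto_intros l) auto
      then have od: "(\<lambda>i. b (2 * i + 1)) \<longlonglongrightarrow> 0" by (simp add: b_def)
      show ?thesis
      proof (rule LIMSEQ_I)
        fix \<epsilon> :: real assume "0 < \<epsilon>"
        obtain N1 where N1: "\<And>i. N1 \<le> i \<Longrightarrow> norm (b (2 * i) - 0) < \<epsilon>"
          using LIMSEQ_D[OF ev \<open>0 < \<epsilon>\<close>] by blast
        obtain N2 where N2: "\<And>i. N2 \<le> i \<Longrightarrow> norm (b (2 * i + 1) - 0) < \<epsilon>"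
          using LIMSEQ_D[OF od \<open>0 < \<epsilon>\<close>] by blast
        have "norm (b n - 0) < \<epsilon>" if "2 * N1 + 2 * N2 + 1 \<le> n" for n
          using that N1[of "n div 2"] N2[of "n div 2"]
          by (cases "even n") (auto elim!: evenE oddE)
        then show "\<exists>no. \<forall>n\<ge>no. norm (b n - 0) < \<epsilon>" by blast
      qed
    qed
  qed (rule k_pos k_rec x_pos z_pos x_step z_step)+
  then show ?thesis by blast
qed

theorem proportional:
  fixes L :: "nat \<Rightarrow> nat"
  assumes L: "\<And>n. 2 \<le> k (n + 1) \<Longrightarrow> L n = 1"
    and c: "c \<le> 1"
    and cond: "filterlim (\<lambda>M. \<Sum>i=1..M. (real (k (2 * i - c)) - 1) / real (k (2 * i - c))
            * sqrt (1 / (real (k (2 * i - 1 - c)) * real (L (2 * i - c))))) at_top sequentially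
       \<or> (\<lambda>M. \<Prod>i=1..M. real (k (2 * i - c))
            / (real (k (2 * i - 1 - c)) + 1 / real (L (2 * i - c)))) \<longlonglongrightarrow> 0"
  shows "\<exists>q. \<forall>n. u n = q * x n \<and> v n = q * z n"
proof -
  interpret c: dominated_pair k x z "\<lambda>n. x n - u n" "\<lambda>n. z n - v n" by (rule complement)
  have *: "c.r m = 1 - r m" "c.s m = 1 - s m" for m
    using x_pos[of m] z_pos[of m] unfolding c.r_def c.s_def r_def s_def
    by (simp_all add: diff_divide_distrib)
  have not_sep: "\<not> separated_pair k x z a b" for a b
    using separated_pair.series_bounded[OF _ c, of k x z a b L]
      separated_pair.product_bounded_below[OF _ c, of k x z a b L] L cond by blast
  consider (above) N where "r N \<le> s N" "r (N + 1) \<le> s N"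
    | (below) N where "s N \<le> r N" "s N \<le> r (N + 1)"
    | (between) "\<And>n. \<not> (r n \<le> s n \<and> r (n + 1) \<le> s n)" "\<And>n. \<not> (s n \<le> r n \<and> s n \<le> r (n + 1))"
    by blast
  then show ?thesis
  proof cases
    case above
    then show ?thesis using above_const const_all by blast
  next
    case below
    then have "c.r N = c.s N \<and> c.r (N + 1) = c.s N" by (intro c.above_const) (auto simp: *)
    then have "r N = s N" "r (N + 1) = s N" unfolding * by auto
    then show ?thesis using const_all by blast
  next
    case between
    \<comment> \<open>Equality would make \<open>s 0\<close> an upper or a lower bound of
      \<open>r 0\<close> and \<open>r 1\<close>. The orientation \<open>s 0 < r 0\<close> is handled
      by the complementary pair.\<close>
    have "r 0 \<noteq> s 0" using between[of 0] by (cases "r 1 \<le> s 0") auto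
    moreover have "\<not> r 0 < s 0" using separated[OF between] not_sep by blast
    ultimately have "c.r 0 < c.s 0" unfolding * by linarith
    moreover have "\<not> (c.r n \<le> c.s n \<and> c.r (n + 1) \<le> c.s n)"
      "\<not> (c.s n \<le> c.r n \<and> c.s n \<le> c.r (n + 1))" for n
      using between[of n] unfolding * by auto
    ultimately show ?thesis using c.separated not_sep by blast
  qed
qed

end

section \<open>Renormalization\<close>

lemma itm_image_eq: "itm_image \<alpha> \<beta> n = (itm \<alpha> \<beta> ^^ n) ` {0..<1}"
  by (induction n) (auto simp: image_image)

text \<open>\<open>W\<close> survives in every image and contains the \<open>N\<close>-th one, so
  the images are constant from \<open>N\<close> on.\<close>

lemma not_type_infinityI:
  assumes "W \<subseteq> {0..<1}" "itm \<alpha> \<beta> ` W = W" "(itm \<alpha> \<beta> ^^ N) ` {0..<1} \<subseteq> W"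
  shows "\<not> type_infinity \<alpha> \<beta>"
proof -
  have W: "W \<subseteq> itm_image \<alpha> \<beta> n" for n
  proof (induction n)
    case (Suc n)
    then show ?case using assms(2) by (metis image_mono itm_image.simps(2))
  qed (use assms(1) in simp)
  have "itm_image \<alpha> \<beta> N = W" using W[of N] assms(3) by (auto simp: itm_image_eq)
  then have "itm_image \<alpha> \<beta> (Suc N) = itm_image \<alpha> \<beta> N" using assms(2) by simp
  then show ?thesis unfolding type_infinity_def by (metis psubset_eq)
qed

locale itm_params =
  fixes \<alpha> \<beta> :: real
  assumes beta_pos: "0 < \<beta>" and beta_less: "\<beta> < \<alpha>" and alpha_less: "\<alpha> < 1"
begin

abbreviation T :: "real \<Rightarrow> real" where "T \<equiv> itm \<alpha> \<beta>"

definition k :: nat where "k = nat \<lfloor>1 / \<alpha>\<rfloor>"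
definition \<alpha>' :: real where "\<alpha>' = \<beta> / \<alpha>"
definition \<beta>' :: real where "\<beta>' = (\<beta> - 1) / \<alpha> + real k"

lemma alpha_pos: "0 < \<alpha>" using beta_pos beta_less by simp

lemma real_k: "real k = of_int \<lfloor>1 / \<alpha>\<rfloor>"
  using alpha_pos by (simp add: k_def)

lemma gauss_map_eq: "gauss_map (\<alpha>, \<beta>) = (\<alpha>', \<beta>')"
  by (simp add: gauss_map_def \<alpha>'_def \<beta>'_def real_k)

lemma k_bounds: "\<alpha> * real k \<le> 1" "1 < \<alpha> * (real k + 1)"
proof -
  have "real k \<le> 1 / \<alpha>" "1 / \<alpha> < real k + 1" unfolding real_k by linarith+
  then show "\<alpha> * real k \<le> 1" "1 < \<alpha> * (real k + 1)"
    using alpha_pos by (simp_all add: field_simps)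
qed

lemma k_pos: "1 \<le> k"
proof (rule ccontr)
  assume "\<not> 1 \<le> k"
  then have "k = 0" by simp
  then show False using k_bounds(2) alpha_less by simp
qed

lemma alpha_mult: "\<alpha> * \<alpha>' = \<beta>" "\<alpha> * \<beta>' = \<beta> - 1 + \<alpha> * real k"
  using alpha_pos by (simp_all add: \<alpha>'_def \<beta>'_def field_simps)

lemma alpha'_bounds: "0 < \<alpha>'" "\<alpha>' < 1"
  using beta_pos beta_less alpha_pos by (simp_all add: \<alpha>'_def)

text \<open>These are \<open>k_bounds\<close> divided by \<open>\<alpha>\<close>. They leave room
  for \<open>\<beta>' \<le> 0\<close>, which only type infinity excludes.\<close>

lemma beta'_bounds: "\<alpha>' - 1 < \<beta>'" "\<beta>' \<le> \<alpha>'"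
proof -
  have "\<alpha> * (\<alpha>' - 1) < \<alpha> * \<beta>'" "\<alpha> * \<beta>' \<le> \<alpha> * \<alpha>'"
    using k_bounds unfolding right_diff_distrib alpha_mult by (simp_all add: algebra_simps)
  then show "\<alpha>' - 1 < \<beta>'" "\<beta>' \<le> \<alpha>'" using alpha_pos by simp_all
qed

lemma T_range: "x \<in> {0..<1} \<Longrightarrow> T x \<in> {0..<1}"
  using beta_pos beta_less alpha_less by (auto simp: itm_def)

lemma T_pow_range: "x \<in> {0..<1} \<Longrightarrow> (T ^^ n) x \<in> {0..<1}"
  by (induction n) (use T_range in auto)

section \<open>The first return to \<open>{1 - \<alpha>..<1}\<close>\<close>

definition \<phi> :: "real \<Rightarrow> real" where "\<phi> y = 1 - \<alpha> + \<alpha> * y"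
definition \<psi> :: "real \<Rightarrow> real" where "\<psi> x = (x - (1 - \<alpha>)) / \<alpha>"

lemma phi_psi: "\<phi> (\<psi> x) = x" "\<psi> (\<phi> y) = y"
  using alpha_pos by (simp_all add: \<phi>_def \<psi>_def)

lemma phi_mem: "\<phi> y \<in> {1 - \<alpha>..<1} \<longleftrightarrow> y \<in> {0..<1}"
proof -
  have "\<alpha> * y < \<alpha> \<longleftrightarrow> y < 1" using alpha_pos by simp
  then show ?thesis using alpha_pos by (auto simp: \<phi>_def zero_le_mult_iff)
qed

lemma psi_mem: "\<psi> x \<in> {0..<1} \<longleftrightarrow> x \<in> {1 - \<alpha>..<1}"
  using phi_mem[of "\<psi> x"] by (simp add: phi_psi)

lemma phi_range: "y \<in> {0..<1} \<Longrightarrow> \<phi> y \<in> {0..<1}"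
  using phi_mem[of y] alpha_less by auto

text \<open>The return time of \<open>\<phi> y\<close>: the middle branch of \<open>T\<close> lands
  in the domain at once; after the last branch the orbit climbs by \<open>\<alpha>\<close> until it
  is back.\<close>

definition ret :: "real \<Rightarrow> nat" where
  "ret y = (if y < 1 - \<alpha>' then 1 else if y < 1 - \<beta>' then k + 1 else k)"

lemma ret_bounds: "1 \<le> ret y" "ret y \<le> k + 1"
  using k_pos by (auto simp: ret_def)

lemma T'_range: "y \<in> {0..<1} \<Longrightarrow> itm \<alpha>' \<beta>' y \<in> {0..<1}"
  using alpha'_bounds beta'_bounds by (auto simp: itm_def)

text \<open>After the last branch the orbit is at \<open>\<beta> + \<alpha> * (y + j - 1)\<close> at
  time \<open>j + 1\<close>, and the definition of \<open>\<beta>'\<close> decides whether it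
  reaches \<open>1 - \<alpha>\<close> at time \<open>k\<close> or \<open>k + 1\<close>. The second
  part says that no earlier return occurs.\<close>

lemma first_return:
  assumes "y \<in> {0..<1}"
  shows "(T ^^ ret y) (\<phi> y) = \<phi> (itm \<alpha>' \<beta>' y)"
    and "\<And>j. 1 \<le> j \<Longrightarrow> j < ret y \<Longrightarrow> (T ^^ j) (\<phi> y) < 1 - \<alpha>"
proof -
  have "(T ^^ ret y) (\<phi> y) = \<phi> (itm \<alpha>' \<beta>' y) \<and>
    (\<forall>j. 1 \<le> j \<longrightarrow> j < ret y \<longrightarrow> (T ^^ j) (\<phi> y) < 1 - \<alpha>)"
  proof (cases "y < 1 - \<alpha>'")
    case True
    then have "\<alpha> * y < \<alpha> * (1 - \<alpha>')" using alpha_pos by simp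
    then have "\<phi> y < 1 - \<beta>" by (simp add: \<phi>_def right_diff_distrib alpha_mult)
    moreover have "1 - \<alpha> \<le> \<phi> y" using phi_mem[of y] assms by simp
    ultimately have "T (\<phi> y) = \<phi> y + \<beta>" by (simp add: itm_def)
    also have "\<dots> = \<phi> (y + \<alpha>')" by (simp add: \<phi>_def distrib_left alpha_mult)
    finally show ?thesis using True by (simp add: ret_def itm_def)
  next
    case False
    then have "\<alpha> * (1 - \<alpha>') \<le> \<alpha> * y" using alpha_pos by simp
    then have start: "1 - \<beta> \<le> \<phi> y" by (simp add: \<phi>_def right_diff_distrib alpha_mult)
    have low: "\<beta> + \<alpha> * (y + real j - 2) < 1 - \<alpha>" if "j < ret y" for j
    proof -
      have "y + real j - 1 < real k - \<beta>'"
      proof (cases "y < 1 - \<beta>'")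
        case True
        then show ?thesis using that False by (simp add: ret_def)
      next
        case False': False
        then have "real j \<le> real k - 1" using that False k_pos by (simp add: ret_def)
        then show ?thesis using assms beta'_bounds alpha'_bounds by simp
      qed
      then have "\<alpha> * (y + real j - 1) < \<alpha> * (real k - \<beta>')" using alpha_pos by simp
      then show ?thesis using alpha_mult by (simp add: algebra_simps)
    qed
    have orbit: "j < ret y \<longrightarrow> (T ^^ Suc j) (\<phi> y) = \<beta> + \<alpha> * (y + real j - 1)" for j
    proof (induction j)
      case 0
      have "\<not> \<phi> y < 1 - \<alpha>" "\<not> \<phi> y < 1 - \<beta>" using start beta_less by auto
      then show ?case by (simp add: itm_def) (simp add: \<phi>_def algebra_simps)
    next
      case (Suc j)
      show ?case
      proof
        assume *: "Suc j < ret y"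
        then have "(T ^^ Suc j) (\<phi> y) = \<beta> + \<alpha> * (y + real j - 1)" using Suc by simp
        moreover from this low[OF *] have "T ((T ^^ Suc j) (\<phi> y)) = (T ^^ Suc j) (\<phi> y) + \<alpha>"
          by (simp add: itm_def algebra_simps)
        ultimately show "(T ^^ Suc (Suc j)) (\<phi> y) = \<beta> + \<alpha> * (y + real (Suc j) - 1)"
          by (simp add: algebra_simps)
      qed
    qed
    have "(T ^^ ret y) (\<phi> y) = \<beta> + \<alpha> * (y + real (ret y) - 2)"
      using orbit[of "ret y - 1"] ret_bounds(1)[of y] by (simp add: of_nat_diff)
    also have "\<dots> = \<phi> (itm \<alpha>' \<beta>' y)"
      using False alpha_mult(2) by (auto simp: ret_def itm_def \<phi>_def algebra_simps)
    finally have "(T ^^ ret y) (\<phi> y) = \<phi> (itm \<alpha>' \<beta>' y)" .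
    moreover have "(T ^^ j) (\<phi> y) < 1 - \<alpha>" if "1 \<le> j" "j < ret y" for j
      using orbit[of "j - 1"] low[of j] that by (simp add: of_nat_diff)
    ultimately show ?thesis by blast
  qed
  then show "(T ^^ ret y) (\<phi> y) = \<phi> (itm \<alpha>' \<beta>' y)"
    and "\<And>j. 1 \<le> j \<Longrightarrow> j < ret y \<Longrightarrow> (T ^^ j) (\<phi> y) < 1 - \<alpha>" by blast+
qed

lemma enters:
  assumes "x \<in> {0..<1}"
  shows "\<exists>j\<le>k. (T ^^ j) x \<in> {1 - \<alpha>..<1}"
proof (rule ccontr)
  assume not: "\<not> ?thesis"
  have small: "(T ^^ j) x < 1 - \<alpha>" if "j \<le> k" for j
    using not that T_pow_range[OF assms, of j] by (meson atLeastLessThan_iff linorder_not_le)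
  have "j \<le> k \<longrightarrow> (T ^^ j) x = x + \<alpha> * real j" for j
  proof (induction j)
    case (Suc j)
    show ?case
    proof
      assume "Suc j \<le> k"
      then show "(T ^^ Suc j) x = x + \<alpha> * real (Suc j)"
        using Suc small[of j] itm_def[of \<alpha> \<beta> "(T ^^ j) x"] by (simp add: algebra_simps)
    qed
  qed simp
  then have "x + \<alpha> * real k < 1 - \<alpha>" using small[of k] by simp
  then show False using k_bounds(2) assms by (simp add: algebra_simps)
qed

lemma return_pow:
  assumes "y \<in> {0..<1}"
  shows "\<exists>i\<le>n * (k + 1). (T ^^ i) (\<phi> y) = \<phi> ((itm \<alpha>' \<beta>' ^^ n) y)"
proof (induction n)
  case 0 then show ?case by simp
next
  case (Suc n)
  then obtain i where i: "i \<le> n * (k + 1)" "(T ^^ i) (\<phi> y) = \<phi> ((itm \<alpha>' \<beta>' ^^ n) y)" by blast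
  define y' where "y' = (itm \<alpha>' \<beta>' ^^ n) y"
  have "y' \<in> {0..<1}" unfolding y'_def using assms T'_range by (induction n) auto
  then have "(T ^^ (ret y' + i)) (\<phi> y) = \<phi> (itm \<alpha>' \<beta>' y')"
    using first_return(1)[of y'] i by (simp add: funpow_add y'_def)
  then show ?case using i(1) ret_bounds(2)[of y']
    by (intro exI[of _ "ret y' + i"]) (auto simp: y'_def)
qed

text \<open>The union \<open>V\<close> of the forward orbits from the copy of \<open>W\<close> is
  again invariant. It absorbs: a point enters the domain within \<open>k\<close> steps, and
  \<open>N\<close> returns take at most \<open>N * (k + 1)\<close> more. No sign of
  \<open>\<beta>'\<close> is assumed, so degenerate renormalized parameters can be excluded with
  it.\<close>

lemma absorbing_lift:
  assumes "W \<subseteq> {0..<1}" "itm \<alpha>' \<beta>' ` W = W" "(itm \<alpha>' \<beta>' ^^ N) ` {0..<1} \<subseteq> W"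
  shows "\<not> type_infinity \<alpha> \<beta>"
proof -
  define V where "V = (\<Union>j. (T ^^ j) ` \<phi> ` W)"
  have sub: "V \<subseteq> {0..<1}"
  proof
    fix v assume "v \<in> V"
    then obtain j y where "y \<in> W" "v = (T ^^ j) (\<phi> y)" by (auto simp: V_def)
    then show "v \<in> {0..<1}" using T_pow_range[OF phi_range, of y j] assms(1) by blast
  qed
  have fwd: "T v \<in> V" if v: "v \<in> V" for v
  proof -
    obtain j y where "y \<in> W" "v = (T ^^ j) (\<phi> y)" using v by (auto simp: V_def)
    then have "T v = (T ^^ Suc j) (\<phi> y)" "y \<in> W" by auto
    then show ?thesis unfolding V_def by blast
  qed
  have "v \<in> T ` V" if v: "v \<in> V" for v
  proof -
    obtain j y where jy: "y \<in> W" "v = (T ^^ j) (\<phi> y)" using v by (auto simp: V_def)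
    show ?thesis
    proof (cases j)
      case 0
      \<comment> \<open>A point of the copy of \<open>W\<close> is reached by the last step of the
        excursion from its preimage under the return map.\<close>
      obtain y' where y': "y' \<in> W" "y = itm \<alpha>' \<beta>' y'" using jy(1) assms(2) by blast
      obtain l where l: "ret y' = Suc l" using ret_bounds(1)[of y'] by (cases "ret y'") auto
      have "v = T ((T ^^ l) (\<phi> y'))" using first_return(1)[of y'] jy y' assms(1) 0 l by auto
      moreover have "(T ^^ l) (\<phi> y') \<in> V" using y' by (auto simp: V_def)
      ultimately show ?thesis by blast
    next
      case (Suc l)
      then have "v = T ((T ^^ l) (\<phi> y))" using jy by simp
      moreover have "(T ^^ l) (\<phi> y) \<in> V" using jy by (auto simp: V_def)
      ultimately show ?thesis by blast
    qed
  qed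
  with fwd have eq: "T ` V = V" by blast
  have fwd_pow: "(T ^^ i) v \<in> V" if "v \<in> V" for i v
    using that fwd by (induction i) auto
  have "(T ^^ (N * (k + 1) + k)) x \<in> V" if x: "x \<in> {0..<1}" for x
  proof -
    obtain j where j: "j \<le> k" "(T ^^ j) x \<in> {1 - \<alpha>..<1}" using enters[OF x] by blast
    define y where "y = \<psi> ((T ^^ j) x)"
    have y: "y \<in> {0..<1}" "(T ^^ j) x = \<phi> y"
      using j by (simp_all add: y_def psi_mem phi_psi del: atLeastLessThan_iff)
    obtain i where i: "i \<le> N * (k + 1)" "(T ^^ i) (\<phi> y) = \<phi> ((itm \<alpha>' \<beta>' ^^ N) y)"
      using return_pow[OF y(1)] by blast
    have "(itm \<alpha>' \<beta>' ^^ N) y \<in> W" using assms(3) y(1) by blast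
    then have "(T ^^ (i + j)) x \<in> V"
      using i(2) y(2) unfolding V_def
      by (simp add: funpow_add) (metis UNIV_I funpow_0 image_eqI)
    moreover have "(T ^^ (N * (k + 1) + k)) x = (T ^^ (N * (k + 1) + k - (i + j))) ((T ^^ (i + j)) x)"
      using funpow_add[of "N * (k + 1) + k - (i + j)" "i + j" T] i(1) j(1)
      by (simp del: funpow.simps)
    ultimately show ?thesis using fwd_pow by simp
  qed
  then show ?thesis using not_type_infinityI[OF sub eq] by blast
qed

text \<open>In each bad case the renormalized map has an invariant absorbing set, which lifts: a
  stable image if type infinity fails, all of [0, 1) for the rotation
  \<open>\<beta>' = \<alpha>'\<close>, and an interval \<open>J\<close> if
  \<open>\<beta>' \<le> 0\<close>.\<close>

lemma renormalized_params:
  assumes "type_infinity \<alpha> \<beta>"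
  shows "itm_params \<alpha>' \<beta>' \<and> type_infinity \<alpha>' \<beta>'"
proof -
  have sub: "itm \<alpha>' \<beta>' ` {0..<1} \<subseteq> {0..<1}" using T'_range by blast
  have inf: "type_infinity \<alpha>' \<beta>'"
  proof (rule ccontr)
    assume "\<not> type_infinity \<alpha>' \<beta>'"
    then obtain n where n: "\<not> itm_image \<alpha>' \<beta>' (Suc n) \<subset> itm_image \<alpha>' \<beta>' n"
      unfolding type_infinity_def by blast
    have dec: "itm_image \<alpha>' \<beta>' (Suc n) \<subseteq> itm_image \<alpha>' \<beta>' n" for n
      by (induction n) (use sub in \<open>auto simp del: atLeastLessThan_iff\<close>)
    have "itm_image \<alpha>' \<beta>' n \<subseteq> {0..<1}" for n
      by (induction n) (use sub in \<open>auto simp del: atLeastLessThan_iff\<close>)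
    moreover have "itm \<alpha>' \<beta>' ` itm_image \<alpha>' \<beta>' n = itm_image \<alpha>' \<beta>' n" using n dec[of n] by auto
    moreover have "(itm \<alpha>' \<beta>' ^^ n) ` {0..<1} \<subseteq> itm_image \<alpha>' \<beta>' n" by (simp add: itm_image_eq)
    ultimately have "\<not> type_infinity \<alpha> \<beta>" by (rule absorbing_lift)
    then show False using assms by simp
  qed
  have "\<beta>' \<noteq> \<alpha>'"
  proof
    assume eq: "\<beta>' = \<alpha>'"
    have "y \<in> itm \<alpha>' \<beta>' ` {0..<1}" if "y \<in> {0..<1}" for y
    proof (cases "y < \<alpha>'")
      case True
      then show ?thesis using that alpha'_bounds
        by (intro image_eqI[of _ _ "y + 1 - \<alpha>'"]) (auto simp: itm_def eq)
    next
      case False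
      then show ?thesis using that alpha'_bounds
        by (intro image_eqI[of _ _ "y - \<alpha>'"]) (auto simp: itm_def eq)
    qed
    then have "itm \<alpha>' \<beta>' ` {0..<1} = {0..<1}" using sub by blast
    then have "\<not> type_infinity \<alpha> \<beta>" by (intro absorbing_lift[where W = "{0..<1}" and N = 0]) auto
    then show False using assms by simp
  qed
  moreover have "0 < \<beta>'"
  proof (rule ccontr)
    assume "\<not> 0 < \<beta>'"
    then have neg: "\<beta>' \<le> 0" by simp
    \<comment> \<open>For \<open>\<beta>' \<le> 0\<close> no point of [0, 1) uses the third branch.
      The map exchanges the two parts of \<open>J\<close> cut at \<open>1 - \<alpha>'\<close>, and
      left of \<open>J\<close> it adds \<open>\<alpha>'\<close>, so every orbit enters
      \<open>J\<close>.\<close>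
    define J where "J = {1 - \<alpha>' + \<beta>'..<1}"
    have J: "J \<subseteq> {0..<1}" using beta'_bounds by (auto simp: J_def)
    have "itm \<alpha>' \<beta>' y \<in> J" if "y \<in> J" for y
      using that neg alpha'_bounds beta'_bounds by (auto simp: J_def itm_def)
    moreover have "y \<in> itm \<alpha>' \<beta>' ` J" if "y \<in> J" for y
    proof (cases "y < 1 + \<beta>'")
      case True
      then show ?thesis using that neg alpha'_bounds beta'_bounds
        by (intro image_eqI[of _ _ "y - \<beta>'"]) (auto simp: J_def itm_def)
    next
      case False
      then show ?thesis using that neg alpha'_bounds beta'_bounds
        by (intro image_eqI[of _ _ "y - \<alpha>'"]) (auto simp: J_def itm_def)
    qed
    ultimately have inv: "itm \<alpha>' \<beta>' ` J = J" by blast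
    have step: "(itm \<alpha>' \<beta>' ^^ n) y \<in> J \<or> (itm \<alpha>' \<beta>' ^^ n) y = y + real n * \<alpha>'" if y: "y \<in> {0..<1}" for y n
    proof (induction n)
      case (Suc n)
      define v where "v = (itm \<alpha>' \<beta>' ^^ n) y"
      have "v \<in> {0..<1}" unfolding v_def using y T'_range by (induction n) auto
      show ?case
      proof (cases "v \<in> J")
        case True
        then show ?thesis using inv by (auto simp: v_def)
      next
        case False
        then have "v < 1 - \<alpha>'" using \<open>v \<in> {0..<1}\<close> neg by (auto simp: J_def)
        then have "itm \<alpha>' \<beta>' v = v + \<alpha>'" by (simp add: itm_def)
        moreover have "v = y + real n * \<alpha>'" using Suc False by (simp add: v_def)
        ultimately show ?thesis by (simp add: v_def algebra_simps)
      qed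
    qed simp
    obtain N :: nat where "1 / \<alpha>' < real N" using reals_Archimedean2 by blast
    then have "1 < real N * \<alpha>'" using alpha'_bounds by (simp add: field_simps)
    have "(itm \<alpha>' \<beta>' ^^ N) y \<in> J" if y: "y \<in> {0..<1}" for y
    proof -
      have "(itm \<alpha>' \<beta>' ^^ N) y \<in> {0..<1}" using y T'_range by (induction N) auto
      then show ?thesis using step[OF y, of N] \<open>1 < real N * \<alpha>'\<close> y by auto
    qed
    then have "\<not> type_infinity \<alpha> \<beta>" by (intro absorbing_lift[OF J inv]) blast
    then show False using assms by simp
  qed
  ultimately show ?thesis using inf beta'_bounds alpha'_bounds by (auto simp: itm_params_def)
qed

end

lemma itm_params_interior:
  assumes "(\<alpha>, \<beta>) \<in> interior paramU"
  shows "itm_params \<alpha> \<beta>"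
proof -
  obtain e where e: "e > 0" "ball (\<alpha>, \<beta>) e \<subseteq> paramU"
    using assms unfolding mem_interior by blast
  have "(\<alpha>, \<beta> - e / 2) \<in> ball (\<alpha>, \<beta>) e" "(\<alpha> - e / 2, \<beta>) \<in> ball (\<alpha>, \<beta>) e"
    "(\<alpha> + e / 2, \<beta>) \<in> ball (\<alpha>, \<beta>) e"
    using e(1) by (auto simp: dist_Pair_Pair dist_real_def)
  then have "(\<alpha>, \<beta> - e / 2) \<in> paramU" "(\<alpha> - e / 2, \<beta>) \<in> paramU" "(\<alpha> + e / 2, \<beta>) \<in> paramU"
    using e(2) by blast+
  then show ?thesis using e(1) by (auto simp: paramU_def itm_params_def)
qed

section \<open>Invariant measures under renormalization\<close>

lemma borel_measurable_itm [measurable]: "itm \<alpha> \<beta> \<in> borel_measurable borel"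
  unfolding itm_def[abs_def] by measurable

text \<open>Not normalized, because restricting to a smaller domain loses mass.\<close>

definition itm_invariant :: "real \<Rightarrow> real \<Rightarrow> real measure \<Rightarrow> bool" where
  "itm_invariant \<alpha> \<beta> M \<longleftrightarrow> sets M = sets borel \<and> finite_measure M \<and> measure M (- {0..<1}) = 0
     \<and> (\<forall>X\<in>sets borel. measure M (itm \<alpha> \<beta> -` X) = measure M X)"

definition renorm :: "real \<Rightarrow> real measure \<Rightarrow> real measure" where
  "renorm a M = distr (density M (indicator {1 - a..<1})) borel (\<lambda>x. (x - (1 - a)) / a)"

locale itm_measure = itm_params +
  fixes M :: "real measure"
  assumes invariant: "itm_invariant \<alpha> \<beta> M"
begin

lemma sets_M [simp, measurable_cong]: "sets M = sets borel"
  using invariant by (simp add: itm_invariant_def)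

lemma space_M [simp]: "space M = UNIV"
  using sets_eq_imp_space_eq[OF sets_M] by simp

sublocale finite_measure M
  using invariant by (simp add: itm_invariant_def)

lemma measure_vimage: "X \<in> sets borel \<Longrightarrow> measure M (T -` X) = measure M X"
  using invariant by (simp add: itm_invariant_def)

lemma T_vimage_borel: "X \<in> sets borel \<Longrightarrow> T -` X \<in> sets borel"
  using measurable_sets[OF borel_measurable_itm, of X \<alpha> \<beta>] by simp

lemma T_pow_measurable [measurable]: "(T ^^ n) \<in> borel_measurable borel"
  by (induction n) (auto simp: o_def)

lemma AE_unit: "AE x in M. x \<in> {0..<1}"
proof (rule AE_I')
  show "- {0..<1} \<in> null_sets M"
    using invariant by (auto simp: itm_invariant_def null_sets_def emeasure_eq_measure)
qed auto

lemma measure_cong_unit: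
  assumes "X \<in> sets borel" "Y \<in> sets borel" "X \<inter> {0..<1} = Y \<inter> {0..<1}"
  shows "measure M X = measure M Y"
proof (rule measure_eq_AE)
  show "AE x in M. x \<in> X \<longleftrightarrow> x \<in> Y"
    using AE_unit by (rule AE_mp) (use assms(3) in \<open>auto simp del: atLeastLessThan_iff\<close>)
qed (use assms in auto)

section \<open>Tails of an invariant measure\<close>

definition g :: "real \<Rightarrow> real" where "g y = measure M {y..<1}"

lemma g_diff:
  assumes "y \<le> y'" "y' \<le> 1" shows "measure M {y..<y'} = g y - g y'"
proof -
  have "{y..<1} = {y..<y'} \<union> {y'..<1}" using assms by auto
  then have "g y = measure M {y..<y'} + g y'"
    unfolding g_def by (simp add: finite_measure_Union)
  then show ?thesis by simp
qed

lemma g_vimage: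
  assumes "Y \<in> sets borel" "T -` {y..<1} \<inter> {0..<1} = Y \<inter> {0..<1}"
  shows "g y = measure M Y"
  unfolding g_def using measure_vimage[of "{y..<1}"] T_vimage_borel assms
  by (metis atLeastLessThan_borel measure_cong_unit)

text \<open>For \<open>y \<le> \<beta>\<close> the first two branches map into
  \<open>{y..<1}\<close> entirely and the last one from \<open>y + 1 - \<beta>\<close> on. In
  \<open>g_mid\<close> the last branch no longer contributes, and in \<open>g_high\<close> the first
  one does so only from \<open>y - \<alpha>\<close> on.\<close>

lemma g_low:
  assumes "0 \<le> y" "y \<le> \<beta>"
  shows "g y = g 0 - g (1 - \<beta>) + g (y + 1 - \<beta>)"
proof -
  have "g y = measure M ({0..<1 - \<beta>} \<union> {y + 1 - \<beta>..<1})"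
    using assms beta_pos beta_less alpha_less
    by (intro g_vimage) (auto simp: itm_def split: if_splits)
  also have "\<dots> = measure M {0..<1 - \<beta>} + measure M {y + 1 - \<beta>..<1}"
    using assms by (intro finite_measure_Union) auto
  also have "measure M {0..<1 - \<beta>} = g 0 - g (1 - \<beta>)"
    using beta_pos beta_less alpha_less by (intro g_diff) auto
  finally show ?thesis by (simp add: g_def)
qed

lemma g_mid:
  assumes "\<beta> \<le> y" "y \<le> \<alpha>" "y \<le> 1 - \<alpha> + \<beta>"
  shows "g y = g 0 - g (1 - \<beta>)"
proof -
  have "g y = measure M {0..<1 - \<beta>}"
    using assms beta_pos beta_less alpha_less
    by (intro g_vimage) (auto simp: itm_def split: if_splits)
  also have "\<dots> = g 0 - g (1 - \<beta>)"
    using beta_pos beta_less alpha_less by (intro g_diff) auto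
  finally show ?thesis .
qed

lemma g_high:
  assumes "\<alpha> \<le> y" "y \<le> 1 - \<alpha> + \<beta>"
  shows "g y = g (y - \<alpha>) - g (1 - \<beta>)"
proof -
  have "g y = measure M {y - \<alpha>..<1 - \<beta>}"
    using assms beta_pos beta_less alpha_less
    by (intro g_vimage) (auto simp: itm_def split: if_splits)
  also have "\<dots> = g (y - \<alpha>) - g (1 - \<beta>)"
    using assms beta_pos beta_less alpha_less by (intro g_diff) auto
  finally show ?thesis .
qed

text \<open>Kac's formula by tails: from \<open>1 - \<alpha>\<close>, \<open>g_high\<close> goes
  down by \<open>\<alpha>\<close> at the price of one \<open>g (1 - \<beta>)\<close> each,
  \<open>k - 1\<close> times, to \<open>1 - \<alpha> * k = \<beta> - \<alpha> * \<beta>'\<close>. As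
  \<open>\<beta>' \<ge> 0\<close>, this is at most \<open>\<beta>\<close>, and \<open>g_low\<close>
  applies.\<close>

lemma mass_recursion:
  assumes "0 \<le> \<beta>'"
  shows "g 0 = g (1 - \<alpha>) + real k * g (1 - \<beta>) - g (1 - \<alpha> * \<beta>')"
proof -
  have "j < k \<longrightarrow> g (1 - \<alpha>) = g (1 - \<alpha> - real j * \<alpha>) - real j * g (1 - \<beta>)" for j
  proof (induction j)
    case (Suc j)
    show ?case
    proof
      assume j: "Suc j < k"
      then have "\<alpha> * (real j + 2) \<le> \<alpha> * real k" using alpha_pos by (intro mult_left_mono) auto
      then have le: "\<alpha> \<le> 1 - \<alpha> - real j * \<alpha>" using k_bounds(1) by (simp add: algebra_simps)
      have "0 \<le> real j * \<alpha>" using alpha_pos by simp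
      then have "g (1 - \<alpha> - real j * \<alpha>) = g (1 - \<alpha> - real j * \<alpha> - \<alpha>) - g (1 - \<beta>)"
        using le beta_pos by (intro g_high) auto
      moreover have "1 - \<alpha> - real j * \<alpha> - \<alpha> = 1 - \<alpha> - real (Suc j) * \<alpha>"
        by (simp add: algebra_simps)
      ultimately show "g (1 - \<alpha>) = g (1 - \<alpha> - real (Suc j) * \<alpha>) - real (Suc j) * g (1 - \<beta>)"
        using Suc j by (simp add: algebra_simps)
    qed
  qed simp
  from this[of "k - 1"] have "g (1 - \<alpha>) = g (1 - \<alpha> - real (k - 1) * \<alpha>) - real (k - 1) * g (1 - \<beta>)"
    using k_pos by simp
  moreover have "1 - \<alpha> - real (k - 1) * \<alpha> = 1 - \<alpha> * real k"
    using k_pos by (simp add: of_nat_diff algebra_simps)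
  moreover have "g (1 - \<alpha> * real k) = g 0 - g (1 - \<beta>) + g (1 - \<alpha> * \<beta>')"
  proof -
    have "0 \<le> \<alpha> * \<beta>'" using assms alpha_pos by simp
    then have "g (1 - \<alpha> * real k) = g 0 - g (1 - \<beta>) + g (1 - \<alpha> * real k + 1 - \<beta>)"
      using k_bounds(1) alpha_mult(2) by (intro g_low) auto
    also have "1 - \<alpha> * real k + 1 - \<beta> = 1 - \<alpha> * \<beta>'" using alpha_mult(2) by simp
    finally show ?thesis .
  qed
  ultimately show ?thesis using k_pos by (simp add: of_nat_diff algebra_simps)
qed

lemma finite_measure_renorm: "finite_measure (renorm \<alpha> M)"
  unfolding renorm_def
  by (intro finite_measure.finite_measure_distr finite_measure_restricted) auto

lemma measure_renorm:
  assumes "X \<in> sets borel"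
  shows "measure (renorm \<alpha> M) X = measure M {x \<in> {1 - \<alpha>..<1}. \<psi> x \<in> X}"
proof -
  have "measure (renorm \<alpha> M) X = measure (density M (indicator {1 - \<alpha>..<1})) (\<psi> -` X)"
    unfolding renorm_def \<psi>_def[abs_def] using assms by (subst measure_distr) auto
  also have "\<dots> = measure M ({1 - \<alpha>..<1} \<inter> \<psi> -` X)"
  proof (rule measure_restricted)
    have "\<psi> \<in> borel_measurable borel" unfolding \<psi>_def[abs_def] by measurable
    from measurable_sets[OF this assms] show "\<psi> -` X \<in> sets M" by simp
  qed simp
  also have "{1 - \<alpha>..<1} \<inter> \<psi> -` X = {x \<in> {1 - \<alpha>..<1}. \<psi> x \<in> X}" by auto
  finally show ?thesis .
qed

lemma renorm_tail:
  assumes "0 \<le> y"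
  shows "measure (renorm \<alpha> M) {y..<1} = g (\<phi> y)"
proof -
  have "{x \<in> {1 - \<alpha>..<1}. \<psi> x \<in> {y..<1}} = {\<phi> y..<1}"
  proof (rule set_eqI)
    fix x
    have "y \<le> \<psi> x \<longleftrightarrow> \<phi> y \<le> x" using alpha_pos by (auto simp: \<psi>_def \<phi>_def field_simps)
    moreover have "1 - \<alpha> \<le> \<phi> y" using assms alpha_pos by (simp add: \<phi>_def)
    ultimately show "x \<in> {x \<in> {1 - \<alpha>..<1}. \<psi> x \<in> {y..<1}} \<longleftrightarrow> x \<in> {\<phi> y..<1}"
      using psi_mem[of x] by auto
  qed
  then show ?thesis by (simp add: measure_renorm g_def)
qed

text \<open>The \<open>i\<close>-th term collects the pasts whose last visit to \<open>D\<close> was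
  \<open>i\<close> steps ago, the remainder those without a visit in the last \<open>n\<close>
  steps. Each induction step pulls the remainder back by \<open>T\<close> and splits it by
  membership in \<open>D\<close>.\<close>

lemma first_entrance_decomposition:
  assumes [measurable]: "D \<in> sets borel" "X \<in> sets borel"
  shows "measure M X
    = (\<Sum>i=1..n. measure M {x \<in> D. (\<forall>j. 1 \<le> j \<and> j < i \<longrightarrow> (T ^^ j) x \<notin> D) \<and> (T ^^ i) x \<in> X})
      + measure M {x. (\<forall>j<n. (T ^^ j) x \<notin> D) \<and> (T ^^ n) x \<in> X}"
proof (induction n)
  case 0 show ?case by simp
next
  case (Suc n)
  define E where "E = {x \<in> D. (\<forall>j. 1 \<le> j \<and> j < Suc n \<longrightarrow> (T ^^ j) x \<notin> D) \<and> (T ^^ Suc n) x \<in> X}"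
  define R where "R n = {x. (\<forall>j<n. (T ^^ j) x \<notin> D) \<and> (T ^^ n) x \<in> X}" for n
  have [measurable]: "Measurable.pred borel (\<lambda>x. (T ^^ j) x \<in> D)" "Measurable.pred borel (\<lambda>x. (T ^^ j) x \<in> X)" for j
    by measurable
  have E: "E \<in> sets borel" unfolding E_def by measurable
  have R: "R n \<in> sets borel" for n unfolding R_def by measurable
  have "T -` R n = E \<union> R (Suc n)"
  proof (rule set_eqI)
    fix x
    have "(\<forall>j<n. (T ^^ j) (T x) \<notin> D) \<longleftrightarrow> (\<forall>j. 1 \<le> j \<and> j < Suc n \<longrightarrow> (T ^^ j) x \<notin> D)"
    proof (intro iffI allI impI)
      fix j assume "\<forall>j<n. (T ^^ j) (T x) \<notin> D" "1 \<le> j \<and> j < Suc n"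
      then show "(T ^^ j) x \<notin> D" by (cases j) (auto simp: funpow_swap1)
    next
      fix j assume "\<forall>j. 1 \<le> j \<and> j < Suc n \<longrightarrow> (T ^^ j) x \<notin> D" "j < n"
      from this(1)[rule_format, of "Suc j"] this(2) show "(T ^^ j) (T x) \<notin> D" by (simp add: funpow_swap1)
    qed
    moreover have "(\<forall>j<Suc n. (T ^^ j) x \<notin> D) \<longleftrightarrow>
        x \<notin> D \<and> (\<forall>j. 1 \<le> j \<and> j < Suc n \<longrightarrow> (T ^^ j) x \<notin> D)"
      by (metis One_nat_def Suc_leI funpow_0 gr0I le_zero_eq zero_less_Suc)
    moreover have "(T ^^ Suc n) x = (T ^^ n) (T x)" by (simp add: funpow_swap1)
    ultimately show "x \<in> T -` R n \<longleftrightarrow> x \<in> E \<union> R (Suc n)"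
      unfolding R_def E_def by auto
  qed
  moreover have "E \<inter> R (Suc n) = {}" unfolding E_def R_def by (force intro: exI[of _ 0])
  ultimately have "measure M (R n) = measure M E + measure M (R (Suc n))"
    using measure_vimage[OF R[of n]] E R finite_measure_Union[of E "R (Suc n)"] by simp
  then show ?case using Suc unfolding E_def R_def by simp
qed

text \<open>In the decomposition of a subset of the domain with \<open>n = k + 1\<close>, the
  remainder is null by \<open>enters\<close>, and the \<open>i\<close>-th term consists of the
  points with return time \<open>i\<close> that return into the subset.\<close>

lemma renorm_invariant: "itm_invariant \<alpha>' \<beta>' (renorm \<alpha> M)"
proof -
  let ?D = "{1 - \<alpha>..<1}"
  have psi [measurable]: "\<psi> \<in> borel_measurable borel" unfolding \<psi>_def[abs_def] by measurable
  have "measure (renorm \<alpha> M) (itm \<alpha>' \<beta>' -` X) = measure (renorm \<alpha> M) X"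
    if X [measurable]: "X \<in> sets borel" for X
  proof -
    have TX: "itm \<alpha>' \<beta>' -` X \<in> sets borel"
      using measurable_sets[OF borel_measurable_itm X] by simp
    define Y where "Y = {x \<in> ?D. \<psi> x \<in> X}"
    have Y [measurable]: "Y \<in> sets borel" unfolding Y_def by measurable
    define E where "E i = {x \<in> ?D. (\<forall>j. 1 \<le> j \<and> j < i \<longrightarrow> (T ^^ j) x \<notin> ?D) \<and> (T ^^ i) x \<in> Y}" for i
    define R where "R = {x. (\<forall>j<k + 1. (T ^^ j) x \<notin> ?D) \<and> (T ^^ (k + 1)) x \<in> Y}"
    have [measurable]: "Measurable.pred borel (\<lambda>x. (T ^^ j) x \<in> ?D)" "Measurable.pred borel (\<lambda>x. (T ^^ j) x \<in> Y)" for j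
      by measurable
    have E_meas: "E i \<in> sets borel" for i unfolding E_def by measurable
    have "R \<in> sets borel" unfolding R_def by measurable
    moreover have "R \<inter> {0..<1} = {} \<inter> {0..<1}"
      using enters unfolding R_def by (fastforce simp del: atLeastLessThan_iff)
    ultimately have "measure M R = 0" using measure_cong_unit[of R "{}"] by simp
    then have sum: "measure M Y = (\<Sum>i=1..k + 1. measure M (E i))"
      using first_entrance_decomposition[of ?D Y "k + 1"] Y unfolding E_def R_def by simp
    have E_eq: "E i = {x \<in> ?D. ret (\<psi> x) = i \<and> itm \<alpha>' \<beta>' (\<psi> x) \<in> X}" if i: "1 \<le> i" for i
    proof (rule set_eqI)
      fix x
      show "x \<in> E i \<longleftrightarrow> x \<in> {x \<in> ?D. ret (\<psi> x) = i \<and> itm \<alpha>' \<beta>' (\<psi> x) \<in> X}"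
      proof (cases "x \<in> ?D")
        case True
        define y where "y = \<psi> x"
        have y: "y \<in> {0..<1}" "x = \<phi> y" using True psi_mem[of x] by (simp_all add: y_def phi_psi)
        note fr = first_return[OF y(1), folded y(2)]
        have at: "(T ^^ ret y) x \<in> ?D"
          using fr(1) phi_mem[of "itm \<alpha>' \<beta>' y"] T'_range[OF y(1)] by simp
        have "ret y = i" if "x \<in> E i"
        proof (rule linorder_cases[of "ret y" i])
          assume "ret y < i"
          then show ?thesis using that at ret_bounds(1)[of y] unfolding E_def by blast
        next
          assume "i < ret y"
          then have "(T ^^ i) x < 1 - \<alpha>" using fr(2) i by blast
          then show ?thesis using that unfolding E_def Y_def by auto
        qed
        moreover have "x \<in> E i \<longleftrightarrow> itm \<alpha>' \<beta>' y \<in> X" if "ret y = i"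
        proof -
          have "(T ^^ j) x \<notin> ?D" if "1 \<le> j \<and> j < i" for j
            using fr(2)[of j] that \<open>ret y = i\<close> by auto
          then have "x \<in> E i \<longleftrightarrow> (T ^^ i) x \<in> Y" using True unfolding E_def by blast
          also have "\<dots> \<longleftrightarrow> itm \<alpha>' \<beta>' y \<in> X"
            using at fr(1) that by (auto simp: Y_def phi_psi)
          finally show ?thesis .
        qed
        ultimately show ?thesis using True unfolding y_def by blast
      next
        case False
        then show ?thesis unfolding E_def by blast
      qed
    qed
    have "measure (renorm \<alpha> M) (itm \<alpha>' \<beta>' -` X) = measure M {x \<in> ?D. \<psi> x \<in> itm \<alpha>' \<beta>' -` X}"
      by (rule measure_renorm[OF TX])
    also have "{x \<in> ?D. \<psi> x \<in> itm \<alpha>' \<beta>' -` X} = (\<Union>i\<in>{1..k + 1}. E i)"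
      using ret_bounds E_eq by fastforce
    also have "measure M \<dots> = (\<Sum>i=1..k + 1. measure M (E i))"
    proof (rule finite_measure_finite_Union)
      show "disjoint_family_on E {1..k + 1}"
        using E_eq unfolding disjoint_family_on_def by auto
    qed (use E_meas in auto)
    also have "\<dots> = measure (renorm \<alpha> M) X" using sum measure_renorm[OF X] by (simp add: Y_def)
    finally show ?thesis .
  qed
  moreover have "{x \<in> ?D. \<psi> x \<in> - {0..<1}} = {}" using psi_mem by fastforce
  then have "measure (renorm \<alpha> M) (- {0..<1}) = 0"
    using measure_renorm[of "- {0..<1}"] by (simp only:) simp
  ultimately show ?thesis
    using finite_measure_renorm by (simp add: itm_invariant_def renorm_def)
qed

end

section \<open>Uniqueness\<close>

locale itm_infinite = itm_params +
  assumes type_inf: "type_infinity \<alpha> \<beta>"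
begin

definition A :: "nat \<Rightarrow> real" where "A n = fst ((gauss_map ^^ n) (\<alpha>, \<beta>))"
definition B :: "nat \<Rightarrow> real" where "B n = snd ((gauss_map ^^ n) (\<alpha>, \<beta>))"
definition \<kappa> :: "nat \<Rightarrow> nat" where "\<kappa> = assoc_seq \<alpha> \<beta>"

lemma levels: "itm_params (A n) (B n) \<and> type_infinity (A n) (B n)"
  and A_Suc: "A (Suc n) = itm_params.\<alpha>' (A n) (B n)"
  and B_Suc: "B (Suc n) = itm_params.\<beta>' (A n) (B n)"
proof -
  have step: "A (Suc n) = itm_params.\<alpha>' (A n) (B n) \<and> B (Suc n) = itm_params.\<beta>' (A n) (B n)"
    if "itm_params (A n) (B n)" for n
    using itm_params.gauss_map_eq[OF that] by (simp add: A_def B_def)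
  have lev: "itm_params (A n) (B n) \<and> type_infinity (A n) (B n)" for n
  proof (induction n)
    case 0
    show ?case using itm_params_axioms type_inf by (simp add: A_def B_def)
  next
    case (Suc n)
    then show ?case using step[of n] itm_params.renormalized_params[of "A n" "B n"] by simp
  qed
  show "itm_params (A n) (B n) \<and> type_infinity (A n) (B n)" by (rule lev)
  show "A (Suc n) = itm_params.\<alpha>' (A n) (B n)" "B (Suc n) = itm_params.\<beta>' (A n) (B n)"
    using step lev by blast+
qed

lemma level_params: "itm_params (A n) (B n)" using levels by blast

lemma level_0: "A 0 = \<alpha>" "B 0 = \<beta>" by (simp_all add: A_def B_def)

lemma kappa_eq: "\<kappa> n = itm_params.k (A n)"
  unfolding \<kappa>_def assoc_seq_def A_def[symmetric] itm_params.k_def[OF level_params] ..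

lemma kappa_pos: "1 \<le> \<kappa> n"
  using itm_params.k_pos[OF level_params] by (simp add: kappa_eq)

lemma A_mult: "A n * A (Suc n) = B n" "A n * B (Suc n) = B n - 1 + A n * real (\<kappa> n)"
  using itm_params.alpha_mult[OF level_params] by (simp_all add: A_Suc B_Suc kappa_eq)

lemma A_bounds: "0 < A n" "A n < 1"
  using itm_params.alpha_pos[OF level_params] itm_params.alpha_less[OF level_params] by auto

definition S :: "nat \<Rightarrow> real" where "S n = (\<Prod>i<n. A i)"

text \<open>\<open>S n\<close> is the length of the \<open>n\<close>-th domain. If \<open>\<kappa>\<close> were 1 along \<open>n, n + 2, \<dots>\<close>, then \<open>S m - S (m + 1)\<close>
  would be a positive constant along these indices.\<close>

lemma kappa_rec: "\<exists>i. 2 \<le> \<kappa> (n + 2 * i)"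
proof (rule ccontr)
  assume "\<not> ?thesis"
  then have one: "\<kappa> (n + 2 * i) = 1" for i
    using kappa_pos[of "n + 2 * i"] by (simp add: not_le) (metis Suc_1 kappa_pos less_2_cases_iff not_less_eq_eq One_nat_def le_antisym less_Suc_eq_le)
  have pos: "0 < S m" for m unfolding S_def using A_bounds by (intro prod_pos) auto
  have dec: "S (Suc m) < S m" for m
    using A_bounds[of m] pos[of m] by (simp add: S_def)
  \<comment> \<open>Lengths do not obey the mass recursion: here \<open>\<kappa> m\<close>
    multiplies \<open>S (m + 1)\<close>, not \<open>S (m + 2)\<close>. For
    \<open>\<kappa> m = 1\<close> the gap at \<open>m + 2\<close> equals the gap at
    \<open>m\<close>.\<close>
  have S3: "S (m + 3) = S (m + 2) - S m + real (\<kappa> m) * S (m + 1)" for m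
  proof -
    have "S (m + 3) = S m * A m * (A (m + 1) * A (m + 2))" by (simp add: S_def numeral_eq_Suc)
    also have "\<dots> = S m * (A m * B (m + 1))" using A_mult(1)[of "m + 1"] by simp
    also have "\<dots> = S m * (B m - 1 + A m * real (\<kappa> m))" using A_mult(2)[of m] by simp
    also have "\<dots> = S m * B m - S m + real (\<kappa> m) * (S m * A m)" by (simp add: algebra_simps)
    also have "S m * B m = S (m + 2)" using A_mult(1)[of m] by (simp add: S_def numeral_eq_Suc)
    finally show ?thesis by (simp add: S_def)
  qed
  define d where "d = S n - S (n + 1)"
  have gap: "S (n + 2 * i) - S (n + 2 * i + 1) = d" for i
  proof (induction i)
    case 0 then show ?case by (simp add: d_def)
  next
    case (Suc i)
    then show ?case using S3[of "n + 2 * i"] one[of i] by (simp add: numeral_eq_Suc)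
  qed
  have "S (n + 2 * i) \<le> S n - real i * d" for i
  proof (induction i)
    case (Suc i)
    have "S (n + 2 * Suc i) \<le> S (n + 2 * i + 1)" using dec[of "n + 2 * i + 1"] by simp
    also have "\<dots> = S (n + 2 * i) - d" using gap[of i] by simp
    also have "\<dots> \<le> S n - real (Suc i) * d" using Suc by (simp add: algebra_simps)
    finally show ?case .
  qed simp
  moreover have "0 < d" using dec[of n] by (simp add: d_def)
  moreover obtain i :: nat where "S n / d < real i" using reals_Archimedean2 by blast
  ultimately show False using pos[of "n + 2 * i"] by (smt (verit) pos_divide_less_eq)
qed

primrec level :: "real measure \<Rightarrow> nat \<Rightarrow> real measure" where
  "level M 0 = M"
| "level M (Suc n) = renorm (A n) (level M n)"

definition mass :: "real measure \<Rightarrow> nat \<Rightarrow> real" where "mass M n = measure (level M n) {0..<1}"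

lemma level_measure:
  assumes "itm_invariant \<alpha> \<beta> M"
  shows "itm_measure (A n) (B n) (level M n)"
proof -
  have "itm_invariant (A n) (B n) (level M n)"
  proof (induction n)
    case 0 show ?case using assms by (simp add: level_0)
  next
    case (Suc n)
    then interpret l: itm_measure "A n" "B n" "level M n"
      using level_params by (simp add: itm_measure_def itm_measure_axioms_def)
    show ?case using l.renorm_invariant by (simp add: A_Suc B_Suc)
  qed
  then show ?thesis using level_params by (simp add: itm_measure_def itm_measure_axioms_def)
qed

lemma level_tail:
  assumes "itm_invariant \<alpha> \<beta> M" "0 \<le> y"
  shows "measure (level M (Suc n)) {y..<1} = measure (level M n) {1 - A n + A n * y..<1}"
proof -
  interpret l: itm_measure "A n" "B n" "level M n" by (rule level_measure[OF assms(1)])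
  show ?thesis using l.renorm_tail[OF assms(2)] by (simp add: l.g_def l.\<phi>_def)
qed

text \<open>The three tails of \<open>mass_recursion\<close> at level \<open>n\<close> are the total
  masses of the next three levels, which turns it into a recursion for \<open>mass\<close>.\<close>

lemma mass_tail:
  assumes "itm_invariant \<alpha> \<beta> M"
  shows "mass M (n + 1) = measure (level M n) {1 - A n..<1}"
    "mass M (n + 2) = measure (level M n) {1 - B n..<1}"
    "mass M (n + 3) = measure (level M n) {1 - A n * B (n + 1)..<1}"
proof -
  show 1: "mass M (n + 1) = measure (level M n) {1 - A n..<1}" for n
    using level_tail[OF assms, of 0 n] by (simp add: mass_def)
  show 2: "mass M (n + 2) = measure (level M n) {1 - B n..<1}" for n
  proof -
    have eq: "1 - A n + A n * (1 - A (Suc n)) = 1 - B n"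
      using A_mult(1)[of n] by (simp add: algebra_simps)
    have "mass M (n + 2) = measure (level M (Suc n)) {1 - A (Suc n)..<1}"
      using 1[of "Suc n"] by (simp del: level.simps)
    also have "\<dots> = measure (level M n) {1 - A n + A n * (1 - A (Suc n))..<1}"
      using A_bounds[of "Suc n"] by (intro level_tail[OF assms]) simp
    finally show ?thesis unfolding eq .
  qed
  have B: "B (Suc n) < 1"
    using itm_params.beta_less[OF level_params[of "Suc n"]] A_bounds[of "Suc n"] by simp
  have eq: "1 - A n + A n * (1 - B (Suc n)) = 1 - A n * B (n + 1)" by (simp add: algebra_simps)
  have "mass M (n + 3) = measure (level M (Suc n)) {1 - B (Suc n)..<1}"
    using 2[of "Suc n"] by (simp del: level.simps add: numeral_3_eq_3)
  also have "\<dots> = measure (level M n) {1 - A n + A n * (1 - B (Suc n))..<1}"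
    using B by (intro level_tail[OF assms]) simp
  finally show "mass M (n + 3) = measure (level M n) {1 - A n * B (n + 1)..<1}" unfolding eq .
qed

lemma mass_step:
  assumes "itm_invariant \<alpha> \<beta> M"
  shows "mass M n = mass M (n + 1) + real (\<kappa> n) * mass M (n + 2) - mass M (n + 3)"
proof -
  interpret l: itm_measure "A n" "B n" "level M n" by (rule level_measure[OF assms])
  have "0 \<le> l.\<beta>'"
    using itm_params.beta_pos[OF level_params, of "Suc n"] by (simp add: B_Suc)
  from l.mass_recursion[OF this] show ?thesis
    unfolding mass_tail[OF assms] by (simp add: mass_def l.g_def kappa_eq B_Suc)
qed

lemma mass_nonneg: "0 \<le> mass M n" by (simp add: mass_def)

lemma mass_anti:
  assumes "itm_invariant \<alpha> \<beta> M"
  shows "mass M (n + 1) \<le> mass M n"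
proof -
  interpret l: itm_measure "A n" "B n" "level M n" by (rule level_measure[OF assms])
  show ?thesis unfolding mass_tail(1)[OF assms] unfolding mass_def
    using A_bounds[of n] by (intro l.finite_measure_mono) auto
qed

text \<open>If the next mass vanished, so would the one after it by monotonicity, and the recursion
  would give \<open>mass M n = - mass M (n + 3)\<close>.\<close>

lemma mass_pos:
  assumes "itm_invariant \<alpha> \<beta> M" "0 < mass M 0"
  shows "0 < mass M n"
proof (induction n)
  case 0 show ?case by (rule assms)
next
  case (Suc n)
  show ?case
  proof (rule ccontr)
    assume "\<not> 0 < mass M (Suc n)"
    then have "mass M (n + 1) = 0" using mass_nonneg[of M "Suc n"] by simp
    moreover from this have "mass M (n + 2) = 0"
      using mass_nonneg[of M "n + 2"] mass_anti[OF assms(1), of "n + 1"] by simp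
    ultimately show False using mass_step[OF assms(1), of n] Suc mass_nonneg[of M "n + 3"] by simp
  qed
qed

text \<open>The decrements of a decreasing nonnegative sequence tend to 0, and where
  \<open>\<kappa> n \<ge> 2\<close> the recursion bounds \<open>mass M (n + 2)\<close> by the
  decrement at \<open>n\<close>.\<close>

lemma mass_small:
  assumes "itm_invariant \<alpha> \<beta> M" "0 < e"
  shows "\<exists>n. mass M n < e"
proof -
  have "decseq (mass M)" by (intro decseq_SucI) (use mass_anti[OF assms(1)] in simp)
  then obtain l where l: "mass M \<longlonglongrightarrow> l"
    by (rule decseq_convergent[of _ 0]) (auto simp: mass_nonneg)
  have "(\<lambda>n. mass M n - mass M (n + 1)) \<longlonglongrightarrow> l - l"
    by (intro tendsto_diff l LIMSEQ_ignore_initial_segment)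
  then have "eventually (\<lambda>n. mass M n - mass M (n + 1) < e) sequentially"
    using assms(2) by (intro order_tendstoD(2)[of _ 0]) auto
  then obtain N where N: "\<And>n. N \<le> n \<Longrightarrow> mass M n - mass M (n + 1) < e"
    by (auto simp: eventually_sequentially)
  obtain i where i: "2 \<le> \<kappa> (N + 2 * i)" using kappa_rec by blast
  define n where "n = N + 2 * i"
  have "2 * mass M (n + 2) \<le> real (\<kappa> n) * mass M (n + 2)"
    using i mass_nonneg[of M "n + 2"] by (intro mult_right_mono) (auto simp: n_def)
  then have "mass M (n + 2) \<le> mass M n - mass M (n + 1)"
    using mass_step[OF assms(1), of n] mass_anti[OF assms(1), of "n + 2"] by (simp add: numeral_eq_Suc)
  also have "\<dots> < e" by (rule N) (simp add: n_def)
  finally show ?thesis by blast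
qed

text \<open>All values of the measure of a periodic orbit are multiples of \<open>1 / p\<close>, and
  renormalization keeps this. Positive masses are then at least \<open>1 / p\<close>, against
  \<open>mass_small\<close>.\<close>

lemma aperiodic:
  assumes "x \<in> {0..<1}" "0 < p"
  shows "(T ^^ p) x \<noteq> x"
proof
  assume per: "(T ^^ p) x = x"
  \<comment> \<open>\<open>p\<close> need not be the least period: the measure counts times, not
    points, and its invariance is the cyclic shift of times.\<close>
  define M where "M = distr (measure_pmf (pmf_of_set {..<p})) borel (\<lambda>i. (T ^^ i) x)"
  have M: "measure M X = real (card {i. i < p \<and> (T ^^ i) x \<in> X}) / real p" if "X \<in> sets borel" for X
  proof -
    have "measure M X = measure (measure_pmf (pmf_of_set {..<p})) ((\<lambda>i. (T ^^ i) x) -` X)"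
      unfolding M_def using that by (subst measure_distr) auto
    also have "\<dots> = real (card ({..<p} \<inter> (\<lambda>i. (T ^^ i) x) -` X)) / real p"
      using assms(2) by (subst measure_pmf_of_set) auto
    also have "{..<p} \<inter> (\<lambda>i. (T ^^ i) x) -` X = {i. i < p \<and> (T ^^ i) x \<in> X}" by auto
    finally show ?thesis .
  qed
  interpret pM: prob_space M
    unfolding M_def by (intro prob_space.prob_space_distr measure_pmf.prob_space_axioms) simp
  have inv: "itm_invariant \<alpha> \<beta> M"
    unfolding itm_invariant_def
  proof (intro conjI ballI)
    show "sets M = sets borel" by (simp add: M_def)
    show "finite_measure M" by (rule pM.finite_measure_axioms)
    have "{i. i < p \<and> (T ^^ i) x \<in> - {0..<1}} = {}"
      using T_pow_range[OF assms(1)] by (auto simp del: atLeastLessThan_iff)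
    then show "measure M (- {0..<1}) = 0" by (subst M) auto
    fix X :: "real set" assume X: "X \<in> sets borel"
    have "bij_betw (\<lambda>i. if Suc i = p then 0 else Suc i) {i. i < p \<and> (T ^^ i) x \<in> T -` X} {i. i < p \<and> (T ^^ i) x \<in> X}"
    proof (rule bij_betwI[where g = "\<lambda>i. if i = 0 then p - 1 else i - 1"])
      have T: "T ((T ^^ i) x) = (T ^^ (if Suc i = p then 0 else Suc i)) x" for i
        using per by auto
      show "(\<lambda>i. if Suc i = p then 0 else Suc i) \<in> {i. i < p \<and> (T ^^ i) x \<in> T -` X} \<rightarrow> {i. i < p \<and> (T ^^ i) x \<in> X}"
      proof
        fix i assume "i \<in> {i. i < p \<and> (T ^^ i) x \<in> T -` X}"
        then show "(if Suc i = p then 0 else Suc i) \<in> {i. i < p \<and> (T ^^ i) x \<in> X}"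
          using T[of i] assms(2) by (simp del: funpow.simps)
      qed
      show "(\<lambda>i. if i = 0 then p - 1 else i - 1) \<in> {i. i < p \<and> (T ^^ i) x \<in> X} \<rightarrow> {i. i < p \<and> (T ^^ i) x \<in> T -` X}"
      proof
        fix i assume i: "i \<in> {i. i < p \<and> (T ^^ i) x \<in> X}"
        define j where "j = (if i = 0 then p - 1 else i - 1)"
        have "(if Suc j = p then 0 else Suc j) = i" "j < p" using i assms(2) by (auto simp: j_def)
        then show "(if i = 0 then p - 1 else i - 1) \<in> {i. i < p \<and> (T ^^ i) x \<in> T -` X}"
          using T[of j] i unfolding j_def by simp
      qed
    qed (use assms(2) in auto)
    then have "card {i. i < p \<and> (T ^^ i) x \<in> T -` X} = card {i. i < p \<and> (T ^^ i) x \<in> X}"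
      by (rule bij_betw_same_card)
    moreover have "T -` X \<in> sets borel"
      using measurable_sets[OF borel_measurable_itm X] by simp
    ultimately show "measure M (T -` X) = measure M X" using X by (simp add: M)
  qed
  have lattice: "\<forall>X\<in>sets borel. \<exists>c::nat. measure (level M n) X = real c / real p" for n
  proof (induction n)
    case 0 show ?case using M by auto
  next
    case (Suc n)
    interpret l: itm_measure "A n" "B n" "level M n" by (rule level_measure[OF inv])
    have [measurable]: "l.\<psi> \<in> borel_measurable borel" unfolding l.\<psi>_def[abs_def] by measurable
    show ?case
    proof
      fix X :: "real set" assume X [measurable]: "X \<in> sets borel"
      have "{x \<in> {1 - A n..<1}. l.\<psi> x \<in> X} \<in> sets borel" by measurable
      then show "\<exists>c::nat. measure (level M (Suc n)) X = real c / real p"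
        using Suc l.measure_renorm[OF X] by simp
    qed
  qed
  have "mass M 0 = 1 - measure M (- {0..<1})"
    using pM.prob_compl[of "- {0..<1}"] by (simp add: mass_def M_def)
  then have "0 < mass M 0" using inv by (simp add: itm_invariant_def)
  have "1 / real p \<le> mass M n" for n
  proof -
    obtain c :: nat where c: "mass M n = real c / real p" using lattice[of n] atLeastLessThan_borel[of 0 1] unfolding mass_def by blast
    then have "c \<noteq> 0" using mass_pos[OF inv \<open>0 < mass M 0\<close>, of n] by (intro notI) simp
    then have "1 \<le> real c" by simp
    then show ?thesis unfolding c by (rule divide_right_mono) simp
  qed
  then show False using mass_small[OF inv, of "1 / real p"] assms(2) by (meson not_less of_nat_0_less_iff zero_less_divide_1_iff)
qed

text \<open>With equal masses the difference \<open>D\<close> of the tails vanishes at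
  \<open>0\<close> and \<open>1 - B n\<close>, so the tail formulas lose their constants:
  \<open>D y\<close> equals \<open>D\<close> at \<open>y + 1 - B n\<close>, at
  \<open>1 - B n\<close> or at \<open>y - A n\<close>. Finitely many such moves lead into the
  domain, whose tails are those of the next level.\<close>

lemma tail_difference_step:
  assumes M: "itm_invariant \<alpha> \<beta> M" and M': "itm_invariant \<alpha> \<beta> M'"
    and eq: "\<And>n. mass M n = mass M' n" and y: "y \<in> {0..<1}"
  shows "\<exists>y'\<in>{0..1}. measure (level M n) {y..<1} - measure (level M' n) {y..<1}
      = measure (level M (Suc n)) {y'..<1} - measure (level M' (Suc n)) {y'..<1}"
proof -
  interpret l: itm_measure "A n" "B n" "level M n" by (rule level_measure[OF M])
  interpret l': itm_measure "A n" "B n" "level M' n" by (rule level_measure[OF M'])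
  define D where "D t = l.g t - l'.g t" for t
  have D0: "D 0 = 0" "D (1 - B n) = 0"
    using eq[of n] eq[of "n + 2"] mass_tail(2)[OF M, of n] mass_tail(2)[OF M', of n]
    by (simp_all add: D_def l.g_def l'.g_def mass_def)
  have top: "\<exists>y'\<in>{0..1}. D y = measure (level M (Suc n)) {y'..<1} - measure (level M' (Suc n)) {y'..<1}"
    if "y \<in> {1 - A n..1}" for y
  proof (intro bexI)
    show "l.\<psi> y \<in> {0..1}" using that A_bounds[of n] by (auto simp: l.\<psi>_def field_simps)
    then show "D y = measure (level M (Suc n)) {l.\<psi> y..<1} - measure (level M' (Suc n)) {l.\<psi> y..<1}"
      using l.renorm_tail[of "l.\<psi> y"] l'.renorm_tail[of "l.\<psi> y"] by (simp add: D_def l.phi_psi)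
  qed
  \<comment> \<open>\<open>j\<close> bounds the number of moves down by \<open>A n\<close>.\<close>
  have "y < 1 \<longrightarrow> 0 \<le> y \<longrightarrow> (\<exists>t\<in>{1 - A n..1}. D y = D t)" if "y < real j * A n" for j y
    using that
  proof (induction j arbitrary: y)
    case (Suc j)
    show ?case
    proof (intro impI)
      assume y: "y < 1" "0 \<le> y"
      consider "y \<le> B n" | "B n < y" "y < A n" "y < 1 - A n" | "A n \<le> y" "y < 1 - A n" | "1 - A n \<le> y"
        by linarith
      then show "\<exists>t\<in>{1 - A n..1}. D y = D t"
      proof cases
        case 1
        then have "D y = D (y + 1 - B n)" using y l.g_low[of y] l'.g_low[of y] D0 by (simp add: D_def)
        then show ?thesis using 1 y l.beta_less by (intro bexI[of _ "y + 1 - B n"]) auto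
      next
        case 2
        then have "D y = D (1 - B n)" using l.g_mid[of y] l'.g_mid[of y] l.beta_pos D0 by (simp add: D_def)
        then show ?thesis using l.beta_less l.beta_pos by (intro bexI[of _ "1 - B n"]) auto
      next
        case 3
        then have "D y = D (y - A n)" using l.g_high[of y] l'.g_high[of y] l.beta_pos D0 by (simp add: D_def)
        moreover have "\<exists>t\<in>{1 - A n..1}. D (y - A n) = D t"
          using Suc.IH[of "y - A n"] Suc.prems 3 y A_bounds[of n] by (simp add: algebra_simps)
        ultimately show ?thesis by simp
      next
        case 4
        then show ?thesis using y by (intro bexI[of _ y]) auto
      qed
    qed
  qed (use A_bounds in auto)
  moreover obtain j :: nat where "y / A n < real j" using reals_Archimedean2 by blast
  then have "y < real j * A n" using A_bounds[of n] by (simp add: field_simps)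
  ultimately obtain t where "t \<in> {1 - A n..1}" "D y = D t"
    using y by (metis atLeastLessThan_iff)
  then show ?thesis using top[of t] by (simp add: D_def l.g_def l'.g_def)
qed

text \<open>After \<open>n\<close> steps the difference is one of tails at level \<open>n\<close>,
  and both of these are at most the common mass.\<close>

lemma tail_difference_le:
  assumes M: "itm_invariant \<alpha> \<beta> M" and M': "itm_invariant \<alpha> \<beta> M'"
    and eq: "\<And>n. mass M n = mass M' n" and y: "0 \<le> y"
  shows "\<bar>measure M {y..<1} - measure M' {y..<1}\<bar> \<le> mass M n"
proof -
  define D where "D n t = measure (level M n) {t..<1} - measure (level M' n) {t..<1}" for n and t :: real
  have "\<exists>t\<ge>0. D 0 y = D n t"
  proof (induction n)
    case 0 then show ?case using y by blast
  next
    case (Suc n)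
    then obtain t where t: "0 \<le> t" "D 0 y = D n t" by blast
    show ?case
    proof (cases "t < 1")
      case True
      then show ?thesis using tail_difference_step[OF M M' eq, of t n] t unfolding D_def by fastforce
    next
      case False
      then show ?thesis using t by (intro exI[of _ t]) (simp add: D_def)
    qed
  qed
  then obtain t where t: "0 \<le> t" "D 0 y = D n t" by blast
  interpret l: itm_measure "A n" "B n" "level M n" by (rule level_measure[OF M])
  interpret l': itm_measure "A n" "B n" "level M' n" by (rule level_measure[OF M'])
  have "measure (level M n) {t..<1} \<le> mass M n"
    unfolding mass_def using t by (intro l.finite_measure_mono) auto
  moreover have "measure (level M' n) {t..<1} \<le> mass M n"
    unfolding eq unfolding mass_def using t by (intro l'.finite_measure_mono) auto
  ultimately have "\<bar>D n t\<bar> \<le> mass M n" unfolding D_def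
    using measure_nonneg[of "level M n" "{t..<1}"] measure_nonneg[of "level M' n" "{t..<1}"] by linarith
  then show ?thesis using t by (simp add: D_def)
qed

lemma invariant_measure_eqI:
  assumes M: "itm_invariant \<alpha> \<beta> M" and M': "itm_invariant \<alpha> \<beta> M'"
    and eq: "\<And>n. mass M n = mass M' n"
  shows "M = M'"
proof -
  have params: "itm_measure \<alpha> \<beta> M" "itm_measure \<alpha> \<beta> M'"
    using M M' itm_params_axioms by (simp_all add: itm_measure_def itm_measure_axioms_def)
  interpret m: itm_measure \<alpha> \<beta> M by fact
  interpret m': itm_measure \<alpha> \<beta> M' by fact
  have tail: "measure M {y..<1} = measure M' {y..<1}" if "0 \<le> y" for y
  proof (rule ccontr)
    assume "\<not> ?thesis"
    then obtain n where "mass M n < \<bar>measure M {y..<1} - measure M' {y..<1}\<bar>"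
      using mass_small[OF M, of "\<bar>measure M {y..<1} - measure M' {y..<1}\<bar>"] by auto
    then show False using tail_difference_le[OF M M' eq that, of n] by simp
  qed
  have "measure M {y..} = measure M' {y..}" for y
  proof -
    have "{y..} \<inter> {0..<1} = {max y 0..<1} \<inter> {0..<1}" by auto
    then show ?thesis
      using m.measure_cong_unit[of "{y..}" "{max y 0..<1}"] m'.measure_cong_unit[of "{y..}" "{max y 0..<1}"] tail[of "max y 0"]
      by simp
  qed
  then have em: "emeasure M {y..} = emeasure M' {y..}" for y
    by (simp add: m.emeasure_eq_measure m'.emeasure_eq_measure)
  show ?thesis
  proof (rule measure_eqI_generator_eq[where E = "range atLeast" and \<Omega> = UNIV and A = "\<lambda>n. {- real n..}"])
    show "Int_stable (range (atLeast :: real \<Rightarrow> real set))"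
    proof (rule Int_stableI)
      fix X Y :: "real set" assume "X \<in> range atLeast" "Y \<in> range atLeast"
      then obtain a b where "X = {a..}" "Y = {b..}" by blast
      then have "X \<inter> Y = {max a b..}" by auto
      then show "X \<inter> Y \<in> range atLeast" by blast
    qed
    show "(\<Union>n. {- real n..}) = UNIV"
    proof (rule set_eqI)
      fix x :: real
      obtain n :: nat where "- x < real n" using reals_Archimedean2 by blast
      then show "x \<in> (\<Union>n. {- real n..}) \<longleftrightarrow> x \<in> UNIV" by (auto intro!: exI[of _ n])
    qed
    show "sets M = sigma_sets UNIV (range atLeast)" "sets M' = sigma_sets UNIV (range atLeast)"
      by (simp_all add: borel_Ici)
  qed (use em in \<open>auto simp: m.emeasure_eq_measure\<close>)
qed

text \<open>\<open>M\<close> is compared with the sum of \<open>M\<close> and \<open>M'\<close>.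
  Strict positivity of \<open>x n\<close> is inherited from a later index of the same parity with
  \<open>\<kappa> \<ge> 2\<close>, as \<open>x\<close> decreases along parities.\<close>

lemma dominated_pair_mass:
  assumes M: "itm_invariant \<alpha> \<beta> M" and M': "itm_invariant \<alpha> \<beta> M'" and pos: "0 < mass M 0"
  shows "dominated_pair \<kappa> (\<lambda>n. mass M n + mass M' n - (mass M (n + 1) + mass M' (n + 1)))
    (\<lambda>n. mass M (n + 2) + mass M' (n + 2)) (\<lambda>n. mass M n - mass M (n + 1)) (\<lambda>n. mass M (n + 2))"
proof -
  define P where "P n = mass M n + mass M' n" for n
  define x where "x n = P n - P (n + 1)" for n
  have P_pos: "0 < P n" for n
    using mass_pos[OF M pos, of n] mass_nonneg[of M' n] by (simp add: P_def)
  have x_nonneg: "0 \<le> x n" for n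
    using mass_anti[OF M, of n] mass_anti[OF M', of n] by (simp add: P_def x_def)
  have x_step: "x n = x (n + 2) + (real (\<kappa> n) - 1) * P (n + 2)" for n
    using mass_step[OF M, of n] mass_step[OF M', of n]
    by (simp add: P_def x_def algebra_simps numeral_eq_Suc)
  have x_anti: "x (n + 2) \<le> x n" for n
    using x_step[of n] kappa_pos[of n] P_pos[of "n + 2"] by simp
  have x_pos: "0 < x n" for n
  proof -
    obtain i where i: "2 \<le> \<kappa> (n + 2 * i)" using kappa_rec by blast
    have "1 * P (n + 2 * i + 2) \<le> (real (\<kappa> (n + 2 * i)) - 1) * P (n + 2 * i + 2)"
      using i P_pos[of "n + 2 * i + 2"] by (intro mult_right_mono) auto
    then have "0 < x (n + 2 * i)"
      using x_step[of "n + 2 * i"] x_nonneg[of "n + 2 * i + 2"] P_pos[of "n + 2 * i + 2"] by linarith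
    also have "x (n + 2 * i) \<le> x n"
    proof (induction i)
      case (Suc i)
      then show ?case using x_anti[of "n + 2 * i"] by simp
    qed simp
    finally show ?thesis .
  qed
  show ?thesis
  proof
    fix n
    show "1 \<le> \<kappa> n" "\<exists>i. 2 \<le> \<kappa> (n + 2 * i)" by (rule kappa_pos kappa_rec)+
    show "0 < mass M n + mass M' n - (mass M (n + 1) + mass M' (n + 1))"
      "0 < mass M (n + 2) + mass M' (n + 2)"
      using x_pos[of n] P_pos[of "n + 2"] by (simp_all add: x_def P_def)
    show "0 \<le> mass M n - mass M (n + 1)"
      "mass M n - mass M (n + 1) \<le> mass M n + mass M' n - (mass M (n + 1) + mass M' (n + 1))"
      using mass_anti[OF M, of n] mass_anti[OF M', of n] by simp_all
    show "0 \<le> mass M (n + 2)" "mass M (n + 2) \<le> mass M (n + 2) + mass M' (n + 2)"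
      using mass_nonneg by simp_all
    show "mass M n + mass M' n - (mass M (n + 1) + mass M' (n + 1)) =
        mass M (n + 2) + mass M' (n + 2) - (mass M (n + 2 + 1) + mass M' (n + 2 + 1)) +
        (real (\<kappa> n) - 1) * (mass M (n + 2) + mass M' (n + 2))"
      using x_step[of n] by (simp add: x_def P_def)
    show "mass M n - mass M (n + 1) = mass M (n + 2) - mass M (n + 2 + 1) + (real (\<kappa> n) - 1) * mass M (n + 2)"
      using mass_step[OF M, of n] by (simp add: algebra_simps numeral_eq_Suc)
  qed (simp_all add: numeral_eq_Suc)
qed

lemma next_non_one_eq_1: "2 \<le> \<kappa> (n + 1) \<Longrightarrow> next_non_one \<kappa> n = 1"
  unfolding next_non_one_def by (rule Least_equality) auto

theorem invariant_measure_unique: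
  assumes M: "itm_invariant \<alpha> \<beta> M" and M': "itm_invariant \<alpha> \<beta> M'"
    and unit: "measure M {0..<1} = 1" "measure M' {0..<1} = 1"
    and c: "c \<le> 1"
    and cond: "filterlim (\<lambda>N. \<Sum>i=1..N. (real (\<kappa> (2 * i - c)) - 1) / real (\<kappa> (2 * i - c))
            * sqrt (1 / (real (\<kappa> (2 * i - 1 - c)) * real (next_non_one \<kappa> (2 * i - c))))) at_top sequentially
       \<or> (\<lambda>N. \<Prod>i=1..N. real (\<kappa> (2 * i - c))
            / (real (\<kappa> (2 * i - 1 - c)) + 1 / real (next_non_one \<kappa> (2 * i - c)))) \<longlonglongrightarrow> 0"
  shows "M = M'"
proof -
  have m0: "mass M 0 = 1" "mass M' 0 = 1" using unit by (simp_all add: mass_def)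
  then interpret dominated_pair \<kappa> "\<lambda>n. mass M n + mass M' n - (mass M (n + 1) + mass M' (n + 1))"
    "\<lambda>n. mass M (n + 2) + mass M' (n + 2)" "\<lambda>n. mass M n - mass M (n + 1)" "\<lambda>n. mass M (n + 2)"
    by (intro dominated_pair_mass[OF M M']) simp
  obtain q where q: "\<And>n. mass M n - mass M (n + 1) = q * (mass M n + mass M' n - (mass M (n + 1) + mass M' (n + 1)))"
    "\<And>n. mass M (n + 2) = q * (mass M (n + 2) + mass M' (n + 2))"
    using proportional[OF next_non_one_eq_1 c cond] by blast
  \<comment> \<open>Proportionality of the masses with index 0 and 1 is recovered from the
    differences.\<close>
  have q1: "mass M 1 = q * (mass M 1 + mass M' 1)"
    using q(1)[of 1] q(2)[of 0] by (simp add: algebra_simps numeral_eq_Suc)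
  have q0: "mass M 0 = q * (mass M 0 + mass M' 0)"
    using q(1)[of 0] q1 by (simp add: algebra_simps)
  then have "q = 1 / 2" using m0 by simp
  have "mass M n = mass M' n" for n
  proof (cases n)
    case 0 then show ?thesis using m0 by simp
  next
    case (Suc j)
    then show ?thesis using q1 q(2)[of "j - 1"] \<open>q = 1 / 2\<close> by (cases j) auto
  qed
  then show ?thesis by (rule invariant_measure_eqI[OF M M'])
qed

end

section \<open>Existence\<close>

text \<open>The translates of \<open>J\<close> by \<open>0, ..., p\<close> are disjoint subsets of
  \<open>{..<N + p}\<close>.\<close>

lemma card_spaced_le:
  fixes J :: "nat set"
  assumes "J \<subseteq> {..<N}" and spaced: "\<And>i j. i \<in> J \<Longrightarrow> j \<in> J \<Longrightarrow> i < j \<Longrightarrow> p < j - i"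
  shows "card J * (p + 1) \<le> N + p"
proof -
  have inj: "inj_on (\<lambda>(j, i). j + i) (J \<times> {..p})"
  proof (rule inj_onI, clarify)
    fix j i j' i' :: nat
    assume *: "j \<in> J" "j' \<in> J" "i \<le> p" "i' \<le> p" "j + i = j' + i'"
    then have "\<not> j < j'" "\<not> j' < j" using spaced[of j j'] spaced[of j' j] by auto
    then show "j = j' \<and> i = i'" using * by auto
  qed
  have "card J * (p + 1) = card ((\<lambda>(j, i). j + i) ` (J \<times> {..p}))"
    by (simp add: card_image[OF inj] card_cartesian_product)
  also have "\<dots> \<le> card {..<N + p}"
    using assms(1) by (intro card_mono) fastforce+
  finally show ?thesis by simp
qed

text \<open>A displacement is a sum of \<open>i\<close> terms from \<open>\<alpha>\<close>,
  \<open>\<beta>\<close> and \<open>\<beta> - 1\<close>.\<close>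

lemma finite_displacements: "finite (range (\<lambda>y. (itm \<alpha> \<beta> ^^ i) y - y))"
proof (induction i)
  case 0 show ?case by simp
next
  case (Suc i)
  have "range (\<lambda>y. (itm \<alpha> \<beta> ^^ Suc i) y - y)
    \<subseteq> (\<lambda>(a, b). a + b) ` ({\<alpha>, \<beta>, \<beta> - 1} \<times> range (\<lambda>y. (itm \<alpha> \<beta> ^^ i) y - y))"
  proof clarify
    fix y
    define v where "v = (itm \<alpha> \<beta> ^^ i) y"
    have "itm \<alpha> \<beta> v - v \<in> {\<alpha>, \<beta>, \<beta> - 1}" by (simp add: itm_def)
    then show "(itm \<alpha> \<beta> ^^ Suc i) y - y
      \<in> (\<lambda>(a, b). a + b) ` ({\<alpha>, \<beta>, \<beta> - 1} \<times> range (\<lambda>y. (itm \<alpha> \<beta> ^^ i) y - y))"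
      by (intro image_eqI[of _ _ "(itm \<alpha> \<beta> v - v, v - y)"]) (auto simp: v_def)
  qed
  then show ?case by (rule finite_subset) (use Suc in simp)
qed

lemma finite_frontier_itm_vimage: "finite (frontier (itm \<alpha> \<beta> -` {..t}))"
proof -
  have eq: "itm \<alpha> \<beta> -` {..t} = ({..<1 - \<alpha>} \<inter> {..t - \<alpha>})
    \<union> (({1 - \<alpha>..} \<inter> {..<1 - \<beta>} \<inter> {..t - \<beta>}) \<union> ({1 - \<alpha>..} \<inter> {1 - \<beta>..} \<inter> {..t + 1 - \<beta>}))"
    by (auto simp: itm_def split: if_splits)
  have Un: "finite (frontier (X \<union> Y))" if "finite (frontier X)" "finite (frontier Y)" for X Y :: "real set"
    using that frontier_Un_subset[of X Y] by (meson finite_UnI finite_subset)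
  have Int: "finite (frontier (X \<inter> Y))" if "finite (frontier X)" "finite (frontier Y)" for X Y :: "real set"
    using that frontier_Int_subset[of X Y] by (meson finite_UnI finite_subset)
  show ?thesis unfolding eq by (intro Un Int) simp_all
qed

context itm_infinite
begin

text \<open>Up to time \<open>p\<close> only finitely many displacements occur, and none is 0 by
  \<open>aperiodic\<close>.\<close>

lemma displacement_gap:
  assumes "1 \<le> p"
  shows "\<exists>\<delta>>0. \<forall>y\<in>{0..<1}. \<forall>i. 1 \<le> i \<and> i \<le> p \<longrightarrow> \<delta> \<le> \<bar>(T ^^ i) y - y\<bar>"
proof -
  define V where "V = (\<Union>i\<in>{1..p}. (\<lambda>y. \<bar>(T ^^ i) y - y\<bar>) ` {0..<1})"
  have "finite ((\<lambda>y. \<bar>(T ^^ i) y - y\<bar>) ` {0..<1})" for i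
  proof (rule finite_subset)
    show "(\<lambda>y. \<bar>(T ^^ i) y - y\<bar>) ` {0..<1} \<subseteq> abs ` range (\<lambda>y. (T ^^ i) y - y)" by auto
    show "finite (abs ` range (\<lambda>y. (T ^^ i) y - y))" using finite_displacements by blast
  qed
  then have "finite V" by (simp add: V_def)
  have "V \<noteq> {}" using assms by (auto simp: V_def)
  have "0 < Min V"
  proof -
    have "0 < v" if "v \<in> V" for v using that aperiodic by (auto simp: V_def simp del: atLeastLessThan_iff)
    then show ?thesis using \<open>finite V\<close> \<open>V \<noteq> {}\<close> by simp
  qed
  moreover have "Min V \<le> \<bar>(T ^^ i) y - y\<bar>" if "y \<in> {0..<1}" "1 \<le> i \<and> i \<le> p" for y i
    using that \<open>finite V\<close> unfolding V_def by (intro Min_le UN_I[of i] imageI) auto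
  ultimately show ?thesis by blast
qed

definition empirical :: "nat \<Rightarrow> real measure" where
  "empirical N = distr (measure_pmf (pmf_of_set {..<Suc N})) borel (\<lambda>j. (T ^^ j) 0)"

lemma real_distribution_empirical: "real_distribution (empirical N)"
  unfolding empirical_def real_distribution_def real_distribution_axioms_def
  by (auto intro!: prob_space.prob_space_distr measure_pmf.prob_space_axioms)

lemma measure_empirical:
  assumes "X \<in> sets borel"
  shows "measure (empirical N) X = real (card {j. j < Suc N \<and> (T ^^ j) 0 \<in> X}) / real (Suc N)"
proof -
  have "measure (empirical N) X = measure (measure_pmf (pmf_of_set {..<Suc N})) ((\<lambda>j. (T ^^ j) 0) -` X)"
    unfolding empirical_def using assms by (subst measure_distr) auto
  also have "\<dots> = real (card ({..<Suc N} \<inter> (\<lambda>j. (T ^^ j) 0) -` X)) / real (Suc N)"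
    by (subst measure_pmf_of_set) auto
  also have "{..<Suc N} \<inter> (\<lambda>j. (T ^^ j) 0) -` X = {j. j < Suc N \<and> (T ^^ j) 0 \<in> X}" by auto
  finally show ?thesis .
qed

lemma empirical_unit: "{0..<1} \<subseteq> X \<Longrightarrow> X \<in> sets borel \<Longrightarrow> measure (empirical N) X = 1"
proof -
  assume X: "{0..<1} \<subseteq> X" "X \<in> sets borel"
  have "{j. j < Suc N \<and> (T ^^ j) 0 \<in> X} = {..<Suc N}"
    using X(1) T_pow_range[of 0] by auto
  then show ?thesis by (simp add: measure_empirical[OF X(2)])
qed

text \<open>The two counts can differ only through the ends of the orbit segment.\<close>

lemma empirical_almost_invariant:
  assumes "X \<in> sets borel"
  shows "\<bar>measure (empirical N) (T -` X) - measure (empirical N) X\<bar> \<le> 1 / real (Suc N)"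
proof -
  define J where "J = {j. j < Suc N \<and> (T ^^ j) 0 \<in> X}"
  define J' where "J' = {j. j < Suc N \<and> (T ^^ j) 0 \<in> T -` X}"
  have fin: "finite J" "finite J'" by (simp_all add: J_def J'_def)
  have "Suc ` J' \<subseteq> insert (Suc N) J" by (auto simp: J_def J'_def)
  then have "card (Suc ` J') \<le> card (insert (Suc N) J)" using fin by (intro card_mono) auto
  then have 1: "card J' \<le> card J + 1" using fin by (simp add: card_image card_insert_if split: if_splits)
  have "J \<subseteq> insert 0 (Suc ` J')"
  proof
    fix j assume "j \<in> J"
    then show "j \<in> insert 0 (Suc ` J')" by (cases j) (auto simp: J_def J'_def)
  qed
  then have "card J \<le> card (insert 0 (Suc ` J'))" using fin by (intro card_mono) auto
  then have 2: "card J \<le> card J' + 1" using fin by (simp add: card_image card_insert_if split: if_splits)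
  have "T -` X \<in> sets borel" using measurable_sets[OF borel_measurable_itm assms] by simp
  then have "measure (empirical N) (T -` X) - measure (empirical N) X = (real (card J') - real (card J)) / real (Suc N)"
    using assms by (simp add: measure_empirical J_def J'_def diff_divide_distrib)
  also have "\<bar>\<dots>\<bar> \<le> 1 / real (Suc N)"
    unfolding abs_divide using 1 2 by (intro frac_le) auto
  finally show ?thesis .
qed

text \<open>Two visits to a window of the width of the displacement gap are more than
  \<open>p\<close> steps apart, so \<open>card_spaced_le\<close> bounds their frequency. Uniformity
  in \<open>N\<close> lets the bound pass to the weak limit.\<close>

lemma empirical_short_interval:
  assumes "1 \<le> p"
  shows "\<exists>\<delta>>0. \<forall>x N. measure (empirical N) {x - \<delta><..<x + \<delta>} \<le> 1 / real (p + 1) + 1 / real (Suc N)"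
proof -
  obtain \<delta> where \<delta>: "0 < \<delta>" "\<And>y i. y \<in> {0..<1} \<Longrightarrow> 1 \<le> i \<Longrightarrow> i \<le> p \<Longrightarrow> \<delta> \<le> \<bar>(T ^^ i) y - y\<bar>"
    using displacement_gap[OF assms] by blast
  have "measure (empirical N) {x - \<delta> / 2<..<x + \<delta> / 2} \<le> 1 / real (p + 1) + 1 / real (Suc N)" for x N
  proof -
    define J where "J = {j. j < Suc N \<and> (T ^^ j) 0 \<in> {x - \<delta> / 2<..<x + \<delta> / 2}}"
    have "card J * (p + 1) \<le> Suc N + p"
    proof (rule card_spaced_le)
      show "J \<subseteq> {..<Suc N}" by (auto simp: J_def)
      fix i j assume ij: "i \<in> J" "j \<in> J" "i < j"
      have "(T ^^ j) 0 = (T ^^ (j - i)) ((T ^^ i) 0)"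
        using funpow_add[of "j - i" i T] ij(3) by simp
      then have "\<bar>(T ^^ (j - i)) ((T ^^ i) 0) - (T ^^ i) 0\<bar> < \<delta>" using ij by (auto simp: J_def)
      then show "p < j - i" using \<delta>(2)[OF T_pow_range[of 0 i], of "j - i"] ij(3) by fastforce
    qed
    then have "real (card J) * real (p + 1) \<le> real (Suc N) + real p"
      by (metis of_nat_add of_nat_le_iff of_nat_mult)
    also have "\<dots> \<le> real (Suc N) + real (p + 1)" by simp
    finally have "real (card J) * real (p + 1) / (real (p + 1) * real (Suc N))
        \<le> (real (Suc N) + real (p + 1)) / (real (p + 1) * real (Suc N))"
      by (rule divide_right_mono) simp
    then have "real (card J) / real (Suc N) \<le> 1 / real (p + 1) + 1 / real (Suc N)"
      by (simp add: add_divide_distrib del: of_nat_Suc of_nat_add)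
    then show ?thesis by (simp add: measure_empirical J_def)
  qed
  then show ?thesis using \<delta>(1) by (intro exI[of _ "\<delta> / 2"]) auto
qed

lemma limit_nonatomic:
  assumes M: "real_distribution M" and sub: "strict_mono \<rho>"
    and conv: "weak_conv_m (empirical \<circ> \<rho>) M"
  shows "measure M {x} = 0"
proof (rule ccontr)
  assume "measure M {x} \<noteq> 0"
  then have pos: "0 < measure M {x}" by (simp add: zero_less_measure_iff)
  interpret M: real_distribution M by fact
  obtain p0 :: nat where p0: "1 / measure M {x} < real p0" using reals_Archimedean2 by blast
  define p where "p = p0 + 1"
  obtain \<delta> where \<delta>: "0 < \<delta>"
    "\<And>N. measure (empirical N) {x - \<delta><..<x + \<delta>} \<le> 1 / real (p + 1) + 1 / real (Suc N)"
    using empirical_short_interval[of p] unfolding p_def by auto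
  \<comment> \<open>A continuous tent between the indicators of the point and of the window, so that
    weak convergence applies.\<close>
  define f where "f t = max 0 (1 - \<bar>t - x\<bar> / \<delta>)" for t
  have f: "0 \<le> f t" "f t \<le> 1" "f t \<le> indicator {x - \<delta><..<x + \<delta>} t" "indicator {x} t \<le> f t" for t
    using \<delta>(1) by (auto simp: f_def indicator_def field_simps)
  have cont: "isCont f t" for t
    unfolding f_def using \<delta>(1) by (intro continuous_intros) auto
  then have f_meas: "f \<in> borel_measurable borel"
    by (intro borel_measurable_continuous_onI continuous_at_imp_continuous_on) auto
  have lim: "(\<lambda>n. integral\<^sup>L ((empirical \<circ> \<rho>) n) f) \<longlonglongrightarrow> integral\<^sup>L M f"
    by (rule weak_conv_imp_integral_bdd_continuous_conv[OF _ M conv, where B = 1])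
      (use real_distribution_empirical cont f in auto)
  have le: "integral\<^sup>L ((empirical \<circ> \<rho>) n) f \<le> 1 / real (p + 1) + 1 / real (Suc n)" for n
  proof -
    interpret e: real_distribution "empirical (\<rho> n)" by (rule real_distribution_empirical)
    have "integral\<^sup>L (empirical (\<rho> n)) f \<le> integral\<^sup>L (empirical (\<rho> n)) (indicator {x - \<delta><..<x + \<delta>})"
    proof (rule integral_mono)
      show "integrable (empirical (\<rho> n)) f"
        by (rule e.integrable_const_bound[of _ 1]) (use f f_meas in auto)
    qed (use f in \<open>auto simp: less_top[symmetric]\<close>)
    also have "\<dots> = measure (empirical (\<rho> n)) {x - \<delta><..<x + \<delta>}" by simp
    also have "\<dots> \<le> 1 / real (p + 1) + 1 / real (Suc (\<rho> n))" by (rule \<delta>(2))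
    also have "\<dots> \<le> 1 / real (p + 1) + 1 / real (Suc n)"
      using seq_suble[OF sub, of n] by (intro add_left_mono divide_left_mono) auto
    finally show ?thesis by simp
  qed
  have "(\<lambda>n. 1 / real (p + 1) + 1 / real (Suc n)) \<longlonglongrightarrow> 1 / real (p + 1) + 0"
    by (intro tendsto_intros LIMSEQ_inverse_real_of_nat[unfolded inverse_eq_divide])
  then have "integral\<^sup>L M f \<le> 1 / real (p + 1)"
    using LIMSEQ_le[OF lim] le by auto
  moreover have "measure M {x} \<le> integral\<^sup>L M f"
  proof -
    have "integral\<^sup>L M (indicator {x}) \<le> integral\<^sup>L M f"
    proof (rule integral_mono)
      show "integrable M f" by (rule M.integrable_const_bound[of _ 1]) (use f f_meas in auto)
    qed (use f in \<open>auto simp: less_top[symmetric]\<close>)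
    then show ?thesis by simp
  qed
  ultimately have "measure M {x} \<le> 1 / real (p + 1)" by simp
  then show False using p0 pos by (simp add: p_def field_simps)
qed

text \<open>For a limit without atoms all sets with finite frontier are continuity sets. Half-lines
  and their preimages under \<open>T\<close> are of this kind, and they determine the distribution
  function.\<close>

theorem invariant_measure_exists:
  "\<exists>M. itm_invariant \<alpha> \<beta> M \<and> prob_space M \<and> measure M {0..<1} = 1"
proof -
  have "tight empirical"
    unfolding tight_def
  proof (intro conjI allI impI)
    fix e :: real assume "0 < e"
    moreover have "measure (empirical n) {- 1<..1} = 1" for n
      by (rule empirical_unit) (auto simp: subset_iff)
    ultimately show "\<exists>a b. a < b \<and> (\<forall>n. 1 - e < measure (empirical n) {a<..b})"
      by (intro exI[of _ "-1"] exI[of _ 1]) simp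
  qed (rule real_distribution_empirical)
  from tight_imp_convergent_subsubsequence[OF this strict_mono_id]
  obtain \<rho> M where \<rho>: "strict_mono \<rho>" and M: "real_distribution M"
    and conv: "weak_conv_m (empirical \<circ> \<rho>) M" by auto
  interpret M: real_distribution M by fact
  have finite_null: "measure M X = 0" if "finite X" for X
    using that limit_nonatomic[OF M \<rho> conv]
    by (subst M.finite_measure_eq_sum_singleton) auto
  have set_conv: "(\<lambda>n. measure (empirical (\<rho> n)) X) \<longlonglongrightarrow> measure M X"
    if "X \<in> sets borel" "finite (frontier X)" for X
  proof -
    have "emeasure M (frontier X) = 0" using finite_null[OF that(2)] by (simp add: M.emeasure_eq_measure)
    then show ?thesis
      using weak_conv_imp_continuity_set_conv[OF _ M conv that(1)] real_distribution_empirical by simp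
  qed
  have T_meas: "T -` X \<in> sets borel" if "X \<in> sets borel" for X
    using measurable_sets[OF borel_measurable_itm that] by simp
  have "frontier {0..<1::real} \<subseteq> {0, 1}" by (auto simp: frontier_def)
  then have "finite (frontier {0..<1::real})" by (rule finite_subset) simp
  from set_conv[OF _ this] have unit: "measure M {0..<1} = 1"
    by (simp add: empirical_unit LIMSEQ_const_iff)
  have half_line: "measure M (T -` {..t}) = measure M {..t}" for t
  proof -
    have "(\<lambda>n. measure (empirical (\<rho> n)) (T -` {..t}) - measure (empirical (\<rho> n)) {..t})
        \<longlonglongrightarrow> measure M (T -` {..t}) - measure M {..t}"
      by (intro tendsto_diff set_conv T_meas finite_frontier_itm_vimage) auto
    moreover have "(\<lambda>n. measure (empirical (\<rho> n)) (T -` {..t}) - measure (empirical (\<rho> n)) {..t}) \<longlonglongrightarrow> 0"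
    proof (rule Lim_null_comparison)
      have "norm (measure (empirical (\<rho> n)) (T -` {..t}) - measure (empirical (\<rho> n)) {..t}) \<le> 1 / real (Suc n)" for n
      proof -
        have "1 / real (Suc (\<rho> n)) \<le> 1 / real (Suc n)"
          using seq_suble[OF \<rho>, of n] by (intro divide_left_mono) auto
        then show ?thesis using empirical_almost_invariant[of "{..t}" "\<rho> n"] by simp
      qed
      then show "\<forall>\<^sub>F n in sequentially. norm (measure (empirical (\<rho> n)) (T -` {..t}) - measure (empirical (\<rho> n)) {..t}) \<le> 1 / real (Suc n)"
        by simp
      show "(\<lambda>n. 1 / real (Suc n)) \<longlonglongrightarrow> 0"
        using LIMSEQ_inverse_real_of_nat by (simp add: inverse_eq_divide)
    qed
    ultimately show ?thesis using LIMSEQ_unique by fastforce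
  qed
  have "distr M borel T = M"
  proof (rule cdf_unique)
    show "real_distribution (distr M borel T)" by (rule M.real_distribution_distr) simp
    show "cdf (distr M borel T) = cdf M"
      by (rule ext) (simp add: cdf_def measure_distr half_line)
  qed (rule M)
  then have "measure M (T -` X) = measure M X" if "X \<in> sets borel" for X
    using that measure_distr[of T M borel X] by simp
  moreover have "measure M (- {0..<1}) = 0" using M.prob_compl[of "{0..<1}"] unit by (simp add: Compl_eq_Diff_UNIV)
  ultimately have "itm_invariant \<alpha> \<beta> M"
    using M.finite_measure_axioms by (simp add: itm_invariant_def)
  then show ?thesis using unit M.prob_space_axioms by blast
qed

end

section \<open>The closure of the attractor\<close>

text \<open>The left-continuous version of \<open>itm\<close>, with \<open>\<le>\<close> in place of
  \<open><\<close>: the value of \<open>itm_closure_map\<close> off the attractor when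
  \<open>\<beta> \<le> \<alpha>\<close>.\<close>

definition left_itm :: "real \<Rightarrow> real \<Rightarrow> real \<Rightarrow> real" where
  "left_itm \<alpha> \<beta> x =
     (if x \<le> 1 - \<alpha> then x + \<alpha>
      else if x \<le> 1 - \<beta> then x + \<beta>
      else x + \<beta> - 1)"

lemma borel_measurable_left_itm [measurable]: "left_itm \<alpha> \<beta> \<in> borel_measurable borel"
  unfolding left_itm_def[abs_def] by measurable

lemma itm_near_left:
  assumes "\<beta> \<le> \<alpha>"
  shows "\<exists>\<epsilon>>0. \<forall>y. x - \<epsilon> < y \<and> y < x \<longrightarrow> itm \<alpha> \<beta> y = y + (left_itm \<alpha> \<beta> x - x)"
proof -
  consider "x \<le> 1 - \<alpha>" | "1 - \<alpha> < x" "x \<le> 1 - \<beta>" | "1 - \<beta> < x" by linarith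
  then show ?thesis
  proof cases
    case 1
    then show ?thesis by (intro exI[of _ 1]) (auto simp: itm_def left_itm_def)
  next
    case 2
    then show ?thesis by (intro exI[of _ "x - (1 - \<alpha>)"]) (auto simp: itm_def left_itm_def)
  next
    case 3
    then show ?thesis using assms by (intro exI[of _ "x - (1 - \<beta>)"]) (auto simp: itm_def left_itm_def)
  qed
qed

lemma Lim_at_left_itm:
  assumes "\<beta> \<le> \<alpha>"
  shows "Lim (at_left x) (itm \<alpha> \<beta>) = left_itm \<alpha> \<beta> x"
proof (rule tendsto_Lim)
  show "at_left x \<noteq> bot" by simp
  obtain \<epsilon> where \<epsilon>: "0 < \<epsilon>" "\<And>y. x - \<epsilon> < y \<Longrightarrow> y < x \<Longrightarrow> itm \<alpha> \<beta> y = y + (left_itm \<alpha> \<beta> x - x)"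
    using itm_near_left[OF assms, of x] by blast
  have "((\<lambda>y. y + (left_itm \<alpha> \<beta> x - x)) \<longlongrightarrow> x + (left_itm \<alpha> \<beta> x - x)) (at_left x)"
    by (intro tendsto_intros)
  moreover have "\<forall>\<^sub>F y in at_left x. itm \<alpha> \<beta> y = y + (left_itm \<alpha> \<beta> x - x)"
    unfolding eventually_at_left_field using \<epsilon> by (intro exI[of _ "x - \<epsilon>"]) auto
  ultimately show "(itm \<alpha> \<beta> \<longlongrightarrow> left_itm \<alpha> \<beta> x) (at_left x)"
    by (subst tendsto_cong) auto
qed

text \<open>A periodic point of the left-continuous map thus has an interval of points with
  \<open>(itm \<alpha> \<beta> ^^ n) y = y\<close> on its left.\<close>

lemma itm_pow_near_left:
  assumes "\<beta> \<le> \<alpha>"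
  shows "\<exists>\<epsilon>>0. \<forall>y. x - \<epsilon> < y \<and> y < x \<longrightarrow> (itm \<alpha> \<beta> ^^ n) y = y + ((left_itm \<alpha> \<beta> ^^ n) x - x)"
proof (induction n)
  case 0 show ?case by (intro exI[of _ 1]) auto
next
  case (Suc n)
  define v where "v = (left_itm \<alpha> \<beta> ^^ n) x"
  obtain \<epsilon>1 where \<epsilon>1: "0 < \<epsilon>1" "\<And>y. x - \<epsilon>1 < y \<Longrightarrow> y < x \<Longrightarrow> (itm \<alpha> \<beta> ^^ n) y = y + (v - x)"
    using Suc by (auto simp: v_def)
  obtain \<epsilon>2 where \<epsilon>2: "0 < \<epsilon>2" "\<And>y. v - \<epsilon>2 < y \<Longrightarrow> y < v \<Longrightarrow> itm \<alpha> \<beta> y = y + (left_itm \<alpha> \<beta> v - v)"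
    using itm_near_left[OF assms, of v] by blast
  have "(itm \<alpha> \<beta> ^^ Suc n) y = y + ((left_itm \<alpha> \<beta> ^^ Suc n) x - x)"
    if "x - min \<epsilon>1 \<epsilon>2 < y" "y < x" for y
    using \<epsilon>1(2)[of y] \<epsilon>2(2)[of "y + (v - x)"] that by (simp add: v_def[symmetric])
  then show ?case using \<epsilon>1(1) \<epsilon>2(1) by (intro exI[of _ "min \<epsilon>1 \<epsilon>2"]) auto
qed

text \<open>Intervals closed on the left and open on the right are cut and translated into intervals
  of the same kind. Hence closures add only right endpoints, and a missing point has a gap on its
  right, which is why left-hand limits are taken at the added points.\<close>

lemma itm_image_intervals:
  "\<exists>F. finite F \<and> itm_image \<alpha> \<beta> n = (\<Union>(a, b)\<in>F. {a..<b})"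
proof (induction n)
  case 0
  show ?case by (intro exI[of _ "{(0, 1)}"]) auto
next
  case (Suc n)
  then obtain F where F: "finite F" "itm_image \<alpha> \<beta> n = (\<Union>(a, b)\<in>F. {a..<b})" by blast
  \<comment> \<open>The last branch begins at the larger of the two cuts, since their order is open
    here; pieces may be empty.\<close>
  define G where "G = (\<lambda>(a, b). {(a + \<alpha>, min b (1 - \<alpha>) + \<alpha>),
    (max a (1 - \<alpha>) + \<beta>, min b (1 - \<beta>) + \<beta>),
    (max a (max (1 - \<alpha>) (1 - \<beta>)) + (\<beta> - 1), b + (\<beta> - 1))})"
  have shift: "(\<lambda>x. x + c) ` {a..<b} = {a + c..<b + c}" for a b c :: real
    by (simp add: image_add_atLeastLessThan')
  have "itm \<alpha> \<beta> ` {a..<b} = (\<Union>(a, b)\<in>G (a, b). {a..<b})" for a b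
  proof -
    have "{a..<b} = {a..<min b (1 - \<alpha>)} \<union> {max a (1 - \<alpha>)..<min b (1 - \<beta>)} \<union> {max a (max (1 - \<alpha>) (1 - \<beta>))..<b}"
      by auto
    then have "itm \<alpha> \<beta> ` {a..<b} = itm \<alpha> \<beta> ` {a..<min b (1 - \<alpha>)}
        \<union> itm \<alpha> \<beta> ` {max a (1 - \<alpha>)..<min b (1 - \<beta>)} \<union> itm \<alpha> \<beta> ` {max a (max (1 - \<alpha>) (1 - \<beta>))..<b}"
      by (metis image_Un)
    also have "itm \<alpha> \<beta> ` {a..<min b (1 - \<alpha>)} = (\<lambda>x. x + \<alpha>) ` {a..<min b (1 - \<alpha>)}"
      by (intro image_cong) (auto simp: itm_def)
    also have "itm \<alpha> \<beta> ` {max a (1 - \<alpha>)..<min b (1 - \<beta>)} = (\<lambda>x. x + \<beta>) ` {max a (1 - \<alpha>)..<min b (1 - \<beta>)}"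
      by (intro image_cong) (auto simp: itm_def)
    also have "itm \<alpha> \<beta> ` {max a (max (1 - \<alpha>) (1 - \<beta>))..<b} = (\<lambda>x. x + (\<beta> - 1)) ` {max a (max (1 - \<alpha>) (1 - \<beta>))..<b}"
      by (intro image_cong) (auto simp: itm_def)
    finally show ?thesis unfolding shift G_def by (simp add: Un_assoc)
  qed
  then have "itm_image \<alpha> \<beta> (Suc n) = (\<Union>(a, b)\<in>(\<Union>p\<in>F. G p). {a..<b})"
    unfolding itm_image.simps F(2) image_UN by (auto simp: split_beta)
  moreover have "finite (\<Union>p\<in>F. G p)" using F(1) by (auto simp: G_def split_beta)
  ultimately show ?case by blast
qed

lemma itm_image_borel [measurable]: "itm_image \<alpha> \<beta> n \<in> sets borel"
proof -
  obtain F where "finite F" "itm_image \<alpha> \<beta> n = (\<Union>(a, b)\<in>F. {a..<b})"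
    using itm_image_intervals by blast
  then show ?thesis by (auto simp: split_beta)
qed

lemma finite_closure_diff_itm_image: "finite (closure (itm_image \<alpha> \<beta> n) - itm_image \<alpha> \<beta> n)"
proof -
  obtain F where F: "finite F" "itm_image \<alpha> \<beta> n = (\<Union>(a, b)\<in>F. {a..<b})"
    using itm_image_intervals by blast
  have "closure (itm_image \<alpha> \<beta> n) \<subseteq> (\<Union>(a, b)\<in>F. {a..b})"
    unfolding F(2) by (rule closure_minimal) (use F(1) in \<open>auto intro!: closed_UN simp: split_beta\<close>)
  then have "closure (itm_image \<alpha> \<beta> n) - itm_image \<alpha> \<beta> n \<subseteq> snd ` F"
    unfolding F(2) by force
  then show ?thesis using F(1) by (meson finite_imageI finite_subset)
qed

lemma itm_image_gap:
  assumes "x \<notin> itm_image \<alpha> \<beta> n"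
  shows "\<exists>\<epsilon>>0. itm_image \<alpha> \<beta> n \<inter> {x..<x + \<epsilon>} = {}"
proof -
  obtain F where F: "finite F" "itm_image \<alpha> \<beta> n = (\<Union>(a, b)\<in>F. {a..<b})"
    using itm_image_intervals by blast
  define P where "P = {a \<in> fst ` F. x < a}"
  define e where "e = Min (insert (x + 1) P)"
  have "finite P" using F(1) by (simp add: P_def)
  then have e: "x < e" "\<And>a. a \<in> P \<Longrightarrow> e \<le> a" by (auto simp: e_def P_def)
  have "itm_image \<alpha> \<beta> n \<inter> {x..<x + (e - x)} = {}"
  proof (rule ccontr)
    assume "\<not> ?thesis"
    then obtain a b y where y: "(a, b) \<in> F" "a \<le> y" "y < b" "x \<le> y" "y < e" unfolding F(2) by auto
    then have "\<not> a \<le> x" using assms unfolding F(2) by fastforce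
    then have "a \<in> P" using y by (force simp: P_def)
    then show False using e(2)[of a] y by simp
  qed
  then show ?thesis using e(1) by (intro exI[of _ "e - x"]) auto
qed

lemma itm_attractor_borel [measurable]: "itm_attractor \<alpha> \<beta> \<in> sets borel"
  unfolding itm_attractor_def by measurable

lemma countable_closure_diff_itm_attractor:
  "countable (closure (itm_attractor \<alpha> \<beta>) - itm_attractor \<alpha> \<beta>)"
proof (rule countable_subset)
  show "closure (itm_attractor \<alpha> \<beta>) - itm_attractor \<alpha> \<beta>
    \<subseteq> (\<Union>n. closure (itm_image \<alpha> \<beta> n) - itm_image \<alpha> \<beta> n)"
  proof
    fix x assume x: "x \<in> closure (itm_attractor \<alpha> \<beta>) - itm_attractor \<alpha> \<beta>"
    then obtain n where "x \<notin> itm_image \<alpha> \<beta> n" by (auto simp: itm_attractor_def)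
    moreover have "closure (itm_attractor \<alpha> \<beta>) \<subseteq> closure (itm_image \<alpha> \<beta> n)"
      by (intro closure_mono) (auto simp: itm_attractor_def)
    ultimately show "x \<in> (\<Union>n. closure (itm_image \<alpha> \<beta> n) - itm_image \<alpha> \<beta> n)" using x by blast
  qed
qed (simp add: countable_finite finite_closure_diff_itm_image)

context itm_infinite
begin

definition \<Omega> :: "real set" where "\<Omega> = itm_attractor \<alpha> \<beta>"
definition X :: "real set" where "X = closure \<Omega>"
definition f :: "real \<Rightarrow> real" where "f = itm_closure_map \<alpha> \<beta>"

lemma Omega_borel [measurable]: "\<Omega> \<in> sets borel" by (simp add: \<Omega>_def)
lemma X_borel [measurable]: "X \<in> sets borel" by (simp add: X_def)
lemma Omega_sub: "\<Omega> \<subseteq> X" by (simp add: X_def closure_subset)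

lemma Omega_unit: "\<Omega> \<subseteq> {0..<1}"
  unfolding \<Omega>_def itm_attractor_def using itm_image.simps(1)[of \<alpha> \<beta>] by blast

lemma X_unit: "X \<subseteq> {0..1}"
  unfolding X_def by (rule closure_minimal) (use Omega_unit in auto)

lemma countable_diff: "countable (X - \<Omega>)"
  unfolding X_def \<Omega>_def by (rule countable_closure_diff_itm_attractor)

lemma f_eq: "f x = (if x \<in> \<Omega> then T x else left_itm \<alpha> \<beta> x)"
  using Lim_at_left_itm[of \<beta> \<alpha> x] beta_less by (simp add: f_def itm_closure_map_def \<Omega>_def)

lemma f_borel [measurable]: "f \<in> borel_measurable borel"
  unfolding f_eq[abs_def] by measurable

lemma T_Omega: "x \<in> \<Omega> \<Longrightarrow> T x \<in> \<Omega>"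
proof -
  assume x: "x \<in> \<Omega>"
  have "T x \<in> itm_image \<alpha> \<beta> n" for n
  proof (cases n)
    case 0
    then show ?thesis using T_range[of x] Omega_unit x by auto
  next
    case (Suc m)
    then show ?thesis using x by (auto simp: \<Omega>_def itm_attractor_def)
  qed
  then show ?thesis by (simp add: \<Omega>_def itm_attractor_def)
qed

text \<open>By \<open>itm_image_gap\<close> there are no points of \<open>\<Omega>\<close> just to
  the right of \<open>x\<close>.\<close>

lemma approach_left:
  assumes "x \<in> X - \<Omega>" "0 < \<epsilon>"
  shows "\<exists>y\<in>\<Omega>. x - \<epsilon> < y \<and> y < x"
proof -
  obtain n where n: "x \<notin> itm_image \<alpha> \<beta> n" using assms(1) by (auto simp: \<Omega>_def itm_attractor_def)
  obtain e where e: "0 < e" "itm_image \<alpha> \<beta> n \<inter> {x..<x + e} = {}" using itm_image_gap[OF n] by blast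
  have "x \<in> closure \<Omega>" using assms(1) by (simp add: X_def)
  moreover have "0 < min \<epsilon> e" using assms(2) e(1) by simp
  ultimately obtain y where y: "y \<in> \<Omega>" "dist y x < min \<epsilon> e"
    unfolding closure_approachable by blast
  have "y \<in> itm_image \<alpha> \<beta> n" using y(1) by (auto simp: \<Omega>_def itm_attractor_def)
  then have "\<not> x \<le> y" using e(2) y(2) by (auto simp: dist_real_def)
  then show ?thesis using y by (intro bexI[of _ y]) (auto simp: dist_real_def)
qed

lemma diff_pos: "x \<in> X - \<Omega> \<Longrightarrow> 0 < x \<and> x \<le> 1"
  using approach_left[of x 1] Omega_unit X_unit by fastforce

text \<open>Off \<open>\<Omega>\<close>, nearby points of \<open>\<Omega>\<close> on the left are
  translated by the same amount as \<open>x\<close>, so their images approach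
  \<open>f x\<close>.\<close>

lemma f_X: "x \<in> X \<Longrightarrow> f x \<in> X"
proof (cases "x \<in> \<Omega>")
  case True
  then show ?thesis using T_Omega Omega_sub by (auto simp: f_eq)
next
  case False
  assume "x \<in> X"
  then have x: "x \<in> X - \<Omega>" using False by simp
  obtain \<epsilon> where \<epsilon>: "0 < \<epsilon>" "\<And>y. x - \<epsilon> < y \<Longrightarrow> y < x \<Longrightarrow> T y = y + (left_itm \<alpha> \<beta> x - x)"
    using itm_near_left[of \<beta> \<alpha> x] beta_less by auto
  have "\<exists>y\<in>\<Omega>. dist y (f x) < e" if "0 < e" for e :: real
  proof -
    obtain y where y: "y \<in> \<Omega>" "x - min e \<epsilon> < y" "y < x"
      using approach_left[OF x, of "min e \<epsilon>"] \<open>0 < e\<close> \<epsilon>(1) by (metis min_less_iff_conj)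
    then have "T y = y + (f x - x)" using \<epsilon>(2)[of y] False by (simp add: f_eq)
    then show ?thesis using y T_Omega[OF y(1)] by (intro bexI[of _ "T y"]) (auto simp: dist_real_def)
  qed
  then show ?thesis unfolding X_def closure_approachable by blast
qed

text \<open>\<open>\<Omega>\<close> is forward invariant, so a periodic orbit lies in it and is one
  of \<open>T\<close>, or avoids it and is one of \<open>left_itm\<close>. In the second case
  \<open>T ^^ p\<close> fixes points of [0, 1) just left of \<open>x\<close>.\<close>

lemma f_aperiodic:
  assumes "x \<in> X" "0 < p"
  shows "(f ^^ p) x \<noteq> x"
proof
  assume per: "(f ^^ p) x = x"
  have stay: "(f ^^ i) y \<in> \<Omega> \<and> (f ^^ i) y = (T ^^ i) y" if "y \<in> \<Omega>" for i y
    using that by (induction i) (auto simp: f_eq T_Omega)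
  show False
  proof (cases "x \<in> \<Omega>")
    case True
    then show False using stay[OF True, of p] per aperiodic[of x p] Omega_unit assms(2) by auto
  next
    case False
    have out: "(f ^^ i) x \<notin> \<Omega>" if "i \<le> p" for i
    proof
      assume "(f ^^ i) x \<in> \<Omega>"
      then have "(f ^^ (p - i)) ((f ^^ i) x) \<in> \<Omega>" using stay by blast
      then have "(f ^^ (p - i + i)) x \<in> \<Omega>" unfolding funpow_add by simp
      then show False using that per False by simp
    qed
    have "i \<le> p \<longrightarrow> (f ^^ i) x = (left_itm \<alpha> \<beta> ^^ i) x" for i
    proof (induction i)
      case (Suc i)
      then show ?case using out[of i] f_eq[of "(f ^^ i) x"] by auto
    qed simp
    then have left: "(left_itm \<alpha> \<beta> ^^ p) x = x" using per by simp
    obtain \<epsilon> where \<epsilon>: "0 < \<epsilon>" "\<And>y. x - \<epsilon> < y \<Longrightarrow> y < x \<Longrightarrow> (T ^^ p) y = y + ((left_itm \<alpha> \<beta> ^^ p) x - x)"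
      using itm_pow_near_left[of \<beta> \<alpha> x p] beta_less by auto
    have x: "0 < x" "x \<le> 1" using diff_pos[of x] assms(1) False by auto
    \<comment> \<open>The minimum with \<open>x\<close> keeps \<open>y\<close> nonnegative.\<close>
    define y where "y = x - min \<epsilon> x / 2"
    have y: "x - \<epsilon> < y" "y < x" "y \<in> {0..<1}" using \<epsilon>(1) x by (auto simp: y_def)
    then have "(T ^^ p) y = y" using \<epsilon>(2)[of y] left by simp
    then show False using aperiodic[OF y(3) assms(2)] by blast
  qed
qed

text \<open>An atom would pass at least its mass on along an orbit that never repeats, exceeding the
  total mass 1. So single points are null, and \<open>X - \<Omega>\<close> is countable.\<close>

lemma invariant_prob_null_diff:
  assumes inv: "invariant_prob X f M"
  shows "X - \<Omega> \<in> null_sets M"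
proof -
  have sets: "sets M = sets (restrict_space borel X)" and f_meas: "f \<in> measurable M M"
    and distr: "distr M M f = M" using inv by (auto simp: invariant_prob_def)
  interpret prob_space M using inv by (simp add: invariant_prob_def)
  have space: "space M = X" using sets_eq_imp_space_eq[OF sets] by (simp add: space_restrict_space)
  have single: "{x} \<in> sets M" if "x \<in> X" for x
    unfolding sets using that by (auto simp: sets_restrict_space_iff)
  have null: "{x} \<in> null_sets M" if x: "x \<in> X" for x
  proof (rule ccontr)
    assume "{x} \<notin> null_sets M"
    then have pos: "0 < prob {x}"
      using single[OF x] by (auto simp: null_sets_def emeasure_eq_measure zero_less_measure_iff)
    have orbit: "(f ^^ i) x \<in> X" for i by (induction i) (auto simp: x f_X)
    have step: "prob {y} \<le> prob {f y}" if "y \<in> X" for y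
    proof -
      have "prob {f y} = measure (distr M M f) {f y}" by (simp add: distr)
      also have "\<dots> = prob (f -` {f y} \<inter> space M)"
        using f_meas single[OF f_X[OF that]] by (rule measure_distr)
      also have "\<dots> \<ge> prob {y}"
        using that f_meas single[OF f_X[OF that]] space
        by (intro finite_measure_mono measurable_sets[OF f_meas]) auto
      finally show ?thesis .
    qed
    have orbit_prob: "prob {x} \<le> prob {(f ^^ i) x}" for i
      by (induction i) (use step orbit in \<open>auto intro: order_trans\<close>)
    have ne: "(f ^^ i) x \<noteq> (f ^^ j) x" if "i < j" for i j
    proof
      assume eq: "(f ^^ i) x = (f ^^ j) x"
      have "(f ^^ (j - i)) ((f ^^ i) x) = (f ^^ j) x"
        using funpow_add[of "j - i" i f] that by simp
      then show False using f_aperiodic[OF orbit[of i], of "j - i"] that eq by simp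
    qed
    then have inj: "inj (\<lambda>i. (f ^^ i) x)" by (intro injI) (metis linorder_neqE_nat)
    obtain n :: nat where n: "1 / prob {x} < real n" using reals_Archimedean2 by blast
    have "real n * prob {x} \<le> (\<Sum>i<n. prob {(f ^^ i) x})"
      using sum_mono[of "{..<n}" "\<lambda>_. prob {x}" "\<lambda>i. prob {(f ^^ i) x}"] orbit_prob by simp
    also have "\<dots> = (\<Sum>y\<in>(\<lambda>i. (f ^^ i) x) ` {..<n}. prob {y})"
      by (subst sum.reindex) (auto intro: inj_on_subset[OF inj])
    also have "\<dots> = prob ((\<lambda>i. (f ^^ i) x) ` {..<n})"
      by (rule finite_measure_eq_sum_singleton[symmetric]) (use single orbit in auto)
    also have "\<dots> \<le> 1" by simp
    finally show False using n pos by (simp add: field_simps)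
  qed
  have "(\<Union>x\<in>X - \<Omega>. {x}) \<in> null_sets M"
    using countable_diff null by (intro null_sets_UN') auto
  then show ?thesis by simp
qed

text \<open>\<open>f\<close> and \<open>T\<close> agree on \<open>\<Omega>\<close>, which carries
  the whole mass, so invariance passes to the line.\<close>

lemma invariant_prob_extend:
  assumes inv: "invariant_prob X f M"
  shows "itm_invariant \<alpha> \<beta> (distr M borel (\<lambda>x. x))"
    and "measure (distr M borel (\<lambda>x. x)) {0..<1} = 1"
    and "\<And>Y. Y \<in> sets borel \<Longrightarrow> measure (distr M borel (\<lambda>x. x)) Y = measure M (Y \<inter> X)"
proof -
  have sets: "sets M = sets (restrict_space borel X)" and f_meas: "f \<in> measurable M M"
    and distr: "distr M M f = M" using inv by (auto simp: invariant_prob_def)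
  interpret prob_space M using inv by (simp add: invariant_prob_def)
  have space: "space M = X" using sets_eq_imp_space_eq[OF sets] by (simp add: space_restrict_space)
  have sets_Int: "Y \<inter> X \<in> sets M" if "Y \<in> sets borel" for Y
    unfolding sets using that by (auto simp: sets_restrict_space_iff)
  have id: "(\<lambda>x. x) \<in> measurable M borel"
    by (rule measurableI) (use sets_Int space in auto)
  let ?D = "distr M borel (\<lambda>x. x)"
  show D: "measure ?D Y = measure M (Y \<inter> X)" if "Y \<in> sets borel" for Y
    using that id space by (subst measure_distr) auto
  have AE_Omega: "AE x in M. x \<in> \<Omega>"
    by (rule AE_I'[OF invariant_prob_null_diff[OF inv]]) (auto simp: space)
  have "prob ({0..<1} \<inter> X) = 1"
  proof -
    have "AE x in M. x \<in> {0..<1} \<inter> X"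
      using AE_Omega by (rule AE_mp) (use Omega_unit Omega_sub in \<open>auto intro!: AE_I2\<close>)
    then show ?thesis using sets_Int[of "{0..<1}"] by (subst prob_eq_1) auto
  qed
  then show unit: "measure ?D {0..<1} = 1" by (simp add: D)
  interpret D: prob_space ?D by (rule prob_space_distr[OF id])
  have "measure ?D (- {0..<1}) = 0"
    using D.prob_compl[of "{0..<1}"] unit by (simp add: Compl_eq_Diff_UNIV)
  moreover have "measure ?D (T -` Y) = measure ?D Y" if Y: "Y \<in> sets borel" for Y
  proof -
    have TY: "T -` Y \<in> sets borel" using measurable_sets[OF borel_measurable_itm Y] by simp
    have "measure ?D Y = measure (distr M M f) (Y \<inter> X)" by (simp add: D[OF Y] distr)
    also have "\<dots> = prob (f -` (Y \<inter> X) \<inter> space M)"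
      using f_meas sets_Int[OF Y] by (rule measure_distr)
    also have "\<dots> = prob (T -` Y \<inter> X)"
    proof (rule measure_eq_AE)
      show "AE x in M. x \<in> f -` (Y \<inter> X) \<inter> space M \<longleftrightarrow> x \<in> T -` Y \<inter> X"
        using AE_Omega by (rule AE_mp) (use T_Omega Omega_sub space in \<open>auto intro!: AE_I2 simp: f_eq\<close>)
    qed (use measurable_sets[OF f_meas sets_Int[OF Y]] sets_Int[OF TY] in auto)
    finally show ?thesis by (simp add: D[OF TY])
  qed
  ultimately show "itm_invariant \<alpha> \<beta> ?D"
    using D.finite_measure_axioms by (simp add: itm_invariant_def)
qed

text \<open>The preimage of the next image contains the current one, so invariance keeps the measure
  of the images at 1.\<close>

lemma attractor_full_measure:
  assumes inv: "itm_invariant \<alpha> \<beta> M" and "prob_space M" and unit: "measure M {0..<1} = 1"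
  shows "AE x in M. x \<in> \<Omega>"
proof -
  interpret prob_space M by fact
  interpret m: itm_measure \<alpha> \<beta> M
    using inv itm_params_axioms by (simp add: itm_measure_def itm_measure_axioms_def)
  have "measure M (itm_image \<alpha> \<beta> n) = 1" for n
  proof (induction n)
    case 0 show ?case using unit by simp
  next
    case (Suc n)
    have "measure M (itm_image \<alpha> \<beta> n) \<le> measure M (T -` itm_image \<alpha> \<beta> (Suc n))"
      by (rule finite_measure_mono) (auto simp: m.T_vimage_borel simp del: itm_image.simps(2), simp)
    also have "\<dots> = measure M (itm_image \<alpha> \<beta> (Suc n))" by (rule m.measure_vimage[OF itm_image_borel])
    finally show ?case using Suc prob_le_1[of "itm_image \<alpha> \<beta> (Suc n)"] by linarith
  qed
  then have "AE x in M. x \<in> itm_image \<alpha> \<beta> n" for n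
    by (subst prob_eq_1[symmetric]) auto
  then have "AE x in M. \<forall>n. x \<in> itm_image \<alpha> \<beta> n" by (simp add: AE_all_countable)
  then show ?thesis by (rule AE_mp) (auto simp: \<Omega>_def itm_attractor_def)
qed

lemma invariant_prob_restrict:
  assumes inv: "itm_invariant \<alpha> \<beta> M" and M: "prob_space M" and unit: "measure M {0..<1} = 1"
  shows "invariant_prob X f (restrict_space M X)"
proof -
  interpret prob_space M by fact
  interpret m: itm_measure \<alpha> \<beta> M
    using inv itm_params_axioms by (simp add: itm_measure_def itm_measure_axioms_def)
  let ?R = "restrict_space M X"
  have AE_Omega: "AE x in M. x \<in> \<Omega>" by (rule attractor_full_measure[OF inv M unit])
  have "AE x in M. x \<in> X" using AE_Omega by (rule AE_mp) (use Omega_sub in auto)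
  then have X1: "emeasure M X = 1" by (intro emeasure_eq_1_AE) auto
  have sets: "sets ?R = sets (restrict_space borel X)" by (rule sets_restrict_space_cong) simp
  have meas: "f \<in> measurable ?R ?R"
    by (intro measurable_restrict_space3) (use f_X in auto)
  have "distr ?R ?R f = ?R"
  proof (rule measure_eqI)
    fix Z assume "Z \<in> sets (distr ?R ?R f)"
    then have Z: "Z \<in> sets ?R" by simp
    then have Z': "Z \<subseteq> X" "Z \<in> sets borel" by (auto simp: sets_restrict_space_iff)
    have fZ: "f -` Z \<inter> X \<in> sets borel" using measurable_sets[OF f_borel Z'(2)] by auto
    have "emeasure (distr ?R ?R f) Z = emeasure ?R (f -` Z \<inter> space ?R)"
      using meas Z by (rule emeasure_distr)
    also have "\<dots> = emeasure M (f -` Z \<inter> X)"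
      by (subst emeasure_restrict_space) (auto simp: space_restrict_space)
    also have "\<dots> = emeasure M (T -` Z)"
    proof (rule emeasure_eq_AE)
      show "AE x in M. x \<in> f -` Z \<inter> X \<longleftrightarrow> x \<in> T -` Z"
        using AE_Omega by (rule AE_mp) (use Omega_sub in \<open>auto simp: f_eq\<close>)
    qed (use fZ m.T_vimage_borel Z' in auto)
    also have "\<dots> = emeasure M Z" using m.measure_vimage[OF Z'(2)] by (simp add: emeasure_eq_measure)
    also have "\<dots> = emeasure ?R Z" using Z'(1) by (subst emeasure_restrict_space) auto
    finally show "emeasure (distr ?R ?R f) Z = emeasure ?R Z" .
  qed simp
  moreover have "prob_space ?R" using X1 by (intro prob_spaceI) (simp add: emeasure_restrict_space space_restrict_space)
  ultimately show ?thesis using sets meas by (simp add: invariant_prob_def)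
qed

theorem uniquely_ergodic:
  assumes "c \<le> 1"
    and "filterlim (\<lambda>N. \<Sum>i=1..N. (real (\<kappa> (2 * i - c)) - 1) / real (\<kappa> (2 * i - c))
            * sqrt (1 / (real (\<kappa> (2 * i - 1 - c)) * real (next_non_one \<kappa> (2 * i - c))))) at_top sequentially
       \<or> (\<lambda>N. \<Prod>i=1..N. real (\<kappa> (2 * i - c))
            / (real (\<kappa> (2 * i - 1 - c)) + 1 / real (next_non_one \<kappa> (2 * i - c)))) \<longlonglongrightarrow> 0"
  shows "itm_uniquely_ergodic \<alpha> \<beta>"
proof -
  have "\<exists>!M. invariant_prob X f M"
  proof (rule ex_ex1I)
    show "\<exists>M. invariant_prob X f M" using invariant_measure_exists invariant_prob_restrict by blast
    fix M M' assume M: "invariant_prob X f M" "invariant_prob X f M'"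
    note e = invariant_prob_extend[OF M(1)] and e' = invariant_prob_extend[OF M(2)]
    have eq: "distr M borel (\<lambda>x. x) = distr M' borel (\<lambda>x. x)"
      by (rule invariant_measure_unique[OF e(1) e'(1) e(2) e'(2) assms])
    have sets: "sets M = sets (restrict_space borel X)" "sets M' = sets (restrict_space borel X)"
      and ps: "prob_space M" "prob_space M'" using M by (auto simp: invariant_prob_def)
    interpret M: prob_space M by (rule ps)
    interpret M': prob_space M' by (rule ps)
    show "M = M'"
    proof (rule measure_eqI)
      fix Z assume "Z \<in> sets M"
      then have "Z \<subseteq> X" "Z \<in> sets borel" unfolding sets by (auto simp: sets_restrict_space_iff)
      then have "measure M Z = measure M' Z" using e(3)[of Z] e'(3)[of Z] eq by (simp add: Int_absorb2)
      then show "emeasure M Z = emeasure M' Z" by (simp add: M.emeasure_eq_measure M'.emeasure_eq_measure)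
    qed (simp add: sets)
  qed
  then show ?thesis
    by (simp add: itm_uniquely_ergodic_def uniquely_ergodic_on_def X_def f_def \<Omega>_def)
qed

end

theorem theorem12:
  fixes \<alpha> \<beta> :: real and k L :: "nat \<Rightarrow> nat"
  assumes "(\<alpha>, \<beta>) \<in> interior paramU"
    and "type_infinity \<alpha> \<beta>"
    and "k = assoc_seq \<alpha> \<beta>"
    and "L = next_non_one k"
    and "filterlim (\<lambda>N. \<Sum>i=1..N. (real (k (2*i)) - 1) / real (k (2*i))
            * sqrt (1 / (real (k (2*i - 1)) * real (L (2*i))))) at_top sequentially
       \<or> (\<lambda>N. \<Prod>i=1..N. real (k (2*i)) / (real (k (2*i - 1)) + 1 / real (L (2*i)))) \<longlonglongrightarrow> 0
       \<or> filterlim (\<lambda>N. \<Sum>i=1..N. (real (k (2*i - 1)) - 1) / real (k (2*i - 1))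
            * sqrt (1 / (real (k (2*i - 2)) * real (L (2*i - 1))))) at_top sequentially
       \<or> (\<lambda>N. \<Prod>i=1..N. real (k (2*i - 1)) / (real (k (2*i - 2)) + 1 / real (L (2*i - 1)))) \<longlonglongrightarrow> 0"
  shows "itm_uniquely_ergodic \<alpha> \<beta>"
proof -
  interpret itm_infinite \<alpha> \<beta>
    using itm_params_interior[OF assms(1)] assms(2)
    by (simp add: itm_infinite_def itm_infinite_axioms_def)
  have k: "k = \<kappa>" and L: "L = next_non_one \<kappa>" using assms(3,4) by (simp_all add: \<kappa>_def)
  \<comment> \<open>Matches the indices for \<open>c = 1\<close>; for \<open>c = 0\<close> they
    agree after \<open>diff_zero\<close>.\<close>
  have "2 * i - 1 - 1 = 2 * i - 2" for i :: nat by simp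
  then show ?thesis
    using assms(5) uniquely_ergodic[of 0] uniquely_ergodic[of 1] unfolding k L
    by (simp only: diff_zero) blast
qed

end
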